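(* Let $G$ be a $2r$-regular graph of order $p$ with $r\ge 1$, $p\ge 3$, $p-2r+2\ge 2$ and $\chi(G)=\chi_{la}(G)$. Let $G_0=G$ and $G_{k+1}=G_k\vee C_{p-2r+2}$ for $k\ge 0$. Then $G_{k+1}$ is a $(2r+(k+1)(p-2r+2))$-regular graph of order $p+(k+1)(p-2r+2)$, and for all $k\ge 0$, $$\chi_{la}(G_k)=\begin{cases}\chi_{la}(G)+2k & \text{if } p \text{ is even},\\ \chi_{la}(G)+3k & \text{otherwise}.\end{cases}$$
   Context: $C_n$ is the cycle on $n$ vertices; each $C_{p-2r+2}$ in the iteration is a fresh vertex-disjoint copy. For vertex-disjoint graphs $G,H$, the join $G\vee H$ has vertex set $V(G)\cup V(H)$ and edge set $E(G)\cup E(H)\cup\{uv: u\in V(G), v\in V(H)\}$. $\chi$ is the chromatic number. For a simple graph with $q$ edges, a bijection $f:E\to\{1,\dots,q\}$ is a local antimagic labeling if $f^+(u)\neq f^+(v)$ for every edge $uv$, where $f^+(u)=\sum_{e\ni u} f(e)$; $\chi_{la}$ is the minimum number of distinct values of $f^+$ over all local antimagic labelings. *)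

theory Defs
  imports Main "HOL-Library.Extended_Nat"
begin

record 'a ugraph =
  verts :: "'a set"
  edges :: "'a set set"

definition simple_graph :: "'a ugraph \<Rightarrow> bool" where
  "simple_graph G \<longleftrightarrow> finite (verts G) \<and> (\<forall>e\<in>edges G. e \<subseteq> verts G \<and> card e = 2)"

definition graph_order :: "'a ugraph \<Rightarrow> nat" where
  "graph_order G = card (verts G)"

definition graph_degree :: "'a ugraph \<Rightarrow> 'a \<Rightarrow> nat" where
  "graph_degree G v = card {e \<in> edges G. v \<in> e}"

definition regular_graph :: "nat \<Rightarrow> 'a ugraph \<Rightarrow> bool" where
  "regular_graph d G \<longleftrightarrow> (\<forall>v\<in>verts G. graph_degree G v = d)"

definition graph_iso :: "'a ugraph \<Rightarrow> 'b ugraph \<Rightarrow> bool" where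
  "graph_iso G H \<longleftrightarrow>
     (\<exists>h. bij_betw h (verts G) (verts H) \<and> edges H = (\<lambda>e. h ` e) ` edges G)"

text \<open>For \<open>n < 3\<close> the following degenerates (a loop or a single edge); the intended
  range is \<open>n \<ge> 3\<close>.\<close>

definition cycle_graph :: "nat \<Rightarrow> nat ugraph" where
  "cycle_graph n = \<lparr>verts = {..<n}, edges = {{i, Suc i mod n} | i. i < n}\<rparr>"

text \<open>The join is only meaningful for graphs with disjoint vertex sets.\<close>

definition graph_join :: "'a ugraph \<Rightarrow> 'a ugraph \<Rightarrow> 'a ugraph" where
  "graph_join G H = \<lparr>verts = verts G \<union> verts H,
     edges = edges G \<union> edges H \<union> {{u, v} | u v. u \<in> verts G \<and> v \<in> verts H}\<rparr>"

definition proper_coloring :: "'a ugraph \<Rightarrow> ('a \<Rightarrow> nat) \<Rightarrow> bool" where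
  "proper_coloring G c \<longleftrightarrow> (\<forall>u v. {u, v} \<in> edges G \<longrightarrow> c u \<noteq> c v)"

definition chromatic_number :: "'a ugraph \<Rightarrow> nat" where
  "chromatic_number G = (LEAST n. \<exists>c. proper_coloring G c \<and> c ` verts G \<subseteq> {..<n})"

definition vertex_sum :: "'a ugraph \<Rightarrow> ('a set \<Rightarrow> nat) \<Rightarrow> 'a \<Rightarrow> nat" where
  "vertex_sum G f v = (\<Sum>e | e \<in> edges G \<and> v \<in> e. f e)"

definition local_antimagic :: "'a ugraph \<Rightarrow> ('a set \<Rightarrow> nat) \<Rightarrow> bool" where
  "local_antimagic G f \<longleftrightarrow> bij_betw f (edges G) {1..card (edges G)} \<and>
     (\<forall>u v. {u, v} \<in> edges G \<longrightarrow> vertex_sum G f u \<noteq> vertex_sum G f v)"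

text \<open>A minimum of natural numbers, taken in \<^typ>\<open>enat\<close> so that a graph without any local
  antimagic labeling gets the value \<open>\<infinity>\<close> instead of an arbitrary number.\<close>

definition chi_la :: "'a ugraph \<Rightarrow> enat" where
  "chi_la G = (INF f \<in> {f. local_antimagic G f}. enat (card (vertex_sum G f ` verts G)))"

text \<open>Over an infinite vertex type, fresh copies of a cycle always exist, so any finite graph
  can be extended to a sequence of iterated joins with pairwise disjoint cycles.\<close>

lemma fresh_cycle:
  fixes A :: "'a set"
  assumes "infinite (UNIV :: 'a set)" "finite A"
  shows "\<exists>C. graph_iso (cycle_graph n) C \<and> verts C \<inter> A = {}"
proof -
  have "infinite (- A)" using assms by (simp add: Compl_eq_Diff_UNIV)
  then obtain B where B: "finite B" "card B = n" "B \<subseteq> - A"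
    using infinite_arbitrarily_large by blast
  then obtain h where h: "bij_betw h {..<n} B"
    using bij_betw_iff_card[of "{..<n}" B] by auto
  have "graph_iso (cycle_graph n) \<lparr>verts = B, edges = (\<lambda>e. h ` e) ` edges (cycle_graph n)\<rparr>"
    using h by (auto simp: graph_iso_def cycle_graph_def)
  then show ?thesis using B(3) by (metis disjoint_eq_subset_Compl ugraph.select_convs(1))
qed

lemma iterated_join_exists:
  fixes G :: "'a ugraph"
  assumes "infinite (UNIV :: 'a set)" "finite (verts G)"
  shows "\<exists>Gs C. Gs 0 = G \<and> (\<forall>k. graph_iso (cycle_graph n) (C k)
           \<and> verts (Gs k) \<inter> verts (C k) = {} \<and> Gs (Suc k) = graph_join (Gs k) (C k))"
proof -
  define P where "P H C \<longleftrightarrow> graph_iso (cycle_graph n) C \<and> verts C \<inter> verts H = {}"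
    for H C :: "'a ugraph"
  define F where "F H = (SOME C. P H C)" for H
  define Gs where "Gs = rec_nat G (\<lambda>_ H. graph_join H (F H))"
  have F: "P H (F H)" if "finite (verts H)" for H
    unfolding F_def using fresh_cycle[OF assms(1) that, of n] by (metis P_def someI_ex)
  have fin: "finite (verts (Gs k))" for k
  proof (induction k)
    case 0
    then show ?case using assms(2) by (simp add: Gs_def)
  next
    case (Suc k)
    from F[OF Suc] have "finite (verts (F (Gs k)))"
      by (auto simp: P_def graph_iso_def cycle_graph_def dest: bij_betw_finite)
    with Suc show ?case by (simp add: Gs_def graph_join_def)
  qed
  have "Gs 0 = G" "\<And>k. Gs (Suc k) = graph_join (Gs k) (F (Gs k))" by (simp_all add: Gs_def)
  moreover have "P (Gs k) (F (Gs k))" for k using F fin by blast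
  ultimately show ?thesis
    by (intro exI[of _ Gs] exI[of _ "\<lambda>k. F (Gs k)"]) (auto simp: P_def)
qed

end

theory Submission
  imports Defs
begin

text \<open>A proper colouring of a join uses disjoint sets of colours on the two sides, so each join with
  \<open>C\<^sub>n\<close> raises the chromatic number by \<open>2\<close> or \<open>3\<close>, and the induced vertex colouring of a local
  antimagic labeling is proper; this bounds \<open>\<chi>\<^sub>l\<^sub>a\<close> from below. Conversely, let \<open>G\<close> be \<open>d\<close>-regular of
  order \<open>p\<close> with \<open>q\<close> edges, \<open>n = p + 2 - d\<close>, and keep an optimal labeling of \<open>G\<close> with the labels
  \<open>1..q\<close>. The larger labels are put on a \<open>p\<close> by \<open>n\<close> array of join edges, all of whose rows have the
  same sum, and on the cycle, so that the colours on \<open>G\<close> are merely translated, while column sum plus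
  the two cycle labels takes only \<open>2\<close> (\<open>n\<close> even) or \<open>3\<close> (\<open>n\<close> odd) values, distinct on adjacent
  cycle vertices and larger than every sum on \<open>G\<close>. For odd \<open>n\<close> the order of the graph alternates in
  parity along the sequence, so arrays with an even and with an odd number of rows are needed.\<close>

section \<open>Joins and cycles\<close>

text \<open>Facts proved for vertices of the left factor transfer to the right factor by this
  symmetry.\<close>

lemma graph_join_commute: "graph_join G H = graph_join H G"
proof -
  have "{{u, v} |u v. u \<in> verts G \<and> v \<in> verts H} = {{u, v} |u v. u \<in> verts H \<and> v \<in> verts G}"
    by (auto simp: insert_commute)
  then show ?thesis
    by (auto simp: graph_join_def)
qed

lemma verts_graph_join [simp]: "verts (graph_join G H) = verts G \<union> verts H"
  by (simp add: graph_join_def)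

lemma simple_graph_finite_edges:
  assumes "simple_graph G"
  shows "finite (edges G)"
proof -
  have "edges G \<subseteq> Pow (verts G)" "finite (Pow (verts G))"
    using assms by (auto simp: simple_graph_def)
  then show ?thesis by (rule finite_subset)
qed

lemma simple_graph_edgeE:
  assumes "simple_graph G" "e \<in> edges G"
  obtains u v where "e = {u, v}" "u \<noteq> v" "u \<in> verts G" "v \<in> verts G"
proof -
  from assms have "card e = 2" "e \<subseteq> verts G" by (auto simp: simple_graph_def)
  then show ?thesis using that by (auto simp: card_2_iff)
qed

lemma simple_graph_edge_verts: "simple_graph G \<Longrightarrow> e \<in> edges G \<Longrightarrow> v \<in> e \<Longrightarrow> v \<in> verts G"
  by (auto simp: simple_graph_def)

lemma simple_graph_join:
  assumes "simple_graph G" "simple_graph H" "verts G \<inter> verts H = {}"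
  shows "simple_graph (graph_join G H)"
proof -
  have "card {u, v} = 2" if "u \<in> verts G" "v \<in> verts H" for u v
    using that assms(3) by (subst card_2_iff') auto
  then show ?thesis
    using assms by (auto simp: simple_graph_def graph_join_def)
qed

lemma vertex_sum_join:
  assumes "simple_graph G" "simple_graph H" "verts G \<inter> verts H = {}" "v \<in> verts G"
  shows "vertex_sum (graph_join G H) f v = vertex_sum G f v + (\<Sum>w\<in>verts H. f {v, w})"
proof -
  let ?star = "(\<lambda>w. {v, w}) ` verts H"
  have eq: "{e. e \<in> edges (graph_join G H) \<and> v \<in> e} = {e. e \<in> edges G \<and> v \<in> e} \<union> ?star"
    using simple_graph_edge_verts[OF assms(2)] assms(3,4) by (auto simp: graph_join_def)
  have disj: "{e. e \<in> edges G \<and> v \<in> e} \<inter> ?star = {}"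
    using simple_graph_edge_verts[OF assms(1)] assms(3) by blast
  have inj: "inj_on (\<lambda>w. {v, w}) (verts H)"
    by (auto simp: inj_on_def doubleton_eq_iff)
  have fin: "finite (verts H)" "finite (edges G)"
    using assms simple_graph_finite_edges by (auto simp: simple_graph_def)
  have "vertex_sum (graph_join G H) f v = sum f ({e. e \<in> edges G \<and> v \<in> e} \<union> ?star)"
    by (simp only: vertex_sum_def eq)
  also have "\<dots> = vertex_sum G f v + sum f ?star"
    unfolding vertex_sum_def using disj fin by (intro sum.union_disjoint) auto
  also have "sum f ?star = (\<Sum>w\<in>verts H. f {v, w})"
    using sum.reindex[OF inj, of f] by simp
  finally show ?thesis .
qed

text \<open>A degree is a vertex sum for the constant labeling \<open>1\<close>, so the sum formulas
  for joins and cycles also compute degrees.\<close>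

lemma graph_degree_vertex_sum: "graph_degree G v = vertex_sum G (\<lambda>_. 1) v"
  by (simp add: graph_degree_def vertex_sum_def)

text \<open>Edges at \<open>v\<close> correspond to other vertices. In the final theorem this rules
  out cycle lengths below \<open>3\<close>.\<close>

lemma graph_degree_less_order:
  assumes "simple_graph G" "v \<in> verts G"
  shows "graph_degree G v < graph_order G"
proof -
  have "{e \<in> edges G. v \<in> e} \<subseteq> (\<lambda>w. {v, w}) ` (verts G - {v})"
  proof
    fix e assume "e \<in> {e \<in> edges G. v \<in> e}"
    then have e: "e \<in> edges G" "v \<in> e" by auto
    obtain a b where "e = {a, b}" "a \<noteq> b" "a \<in> verts G" "b \<in> verts G"
      using simple_graph_edgeE[OF assms(1) e(1)] by blast
    then show "e \<in> (\<lambda>w. {v, w}) ` (verts G - {v})"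
      using e(2) by (auto simp: insert_commute)
  qed
  moreover have fin: "finite (verts G)" using assms by (simp add: simple_graph_def)
  ultimately have "graph_degree G v \<le> card (verts G - {v})"
    unfolding graph_degree_def by (meson card_image_le card_mono finite_Diff finite_imageI le_trans)
  moreover have "card (verts G - {v}) < card (verts G)"
    using fin assms(2) by (rule card_Diff1_less)
  ultimately show ?thesis by (simp add: graph_order_def)
qed

lemma regular_graph_join:
  assumes "simple_graph G" "simple_graph H" "verts G \<inter> verts H = {}"
    and "regular_graph d G" "regular_graph d' H"
    and "d + graph_order H = d' + graph_order G"
  shows "regular_graph (d + graph_order H) (graph_join G H)"
  unfolding regular_graph_def
proof
  fix v assume v: "v \<in> verts (graph_join G H)"
  show "graph_degree (graph_join G H) v = d + graph_order H"
  proof (cases "v \<in> verts G")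
    case True
    then show ?thesis
      using vertex_sum_join[OF assms(1-3) True, of "\<lambda>_. 1"] assms(4)
      by (simp add: graph_degree_vertex_sum regular_graph_def graph_order_def)
  next
    case False
    then have vH: "v \<in> verts H" using v by simp
    have "verts H \<inter> verts G = {}" using assms(3) by blast
    from vertex_sum_join[OF assms(2,1) this vH, of "\<lambda>_. 1"] show ?thesis
      using assms(5,6) vH
      by (simp add: graph_degree_vertex_sum regular_graph_def graph_order_def graph_join_commute[of G])
  qed
qed

section \<open>Cycles given by a parametrisation of their vertices\<close>

definition cycle_edge :: "nat \<Rightarrow> (nat \<Rightarrow> 'a) \<Rightarrow> nat \<Rightarrow> 'a set" where
  "cycle_edge n h i = {h i, h (Suc i mod n)}"

text \<open>The bound \<open>3 \<le> n\<close> is built in because shorter cycles degenerate to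
  loops or repeated edges.\<close>

definition cycle_on :: "nat \<Rightarrow> (nat \<Rightarrow> 'a) \<Rightarrow> 'a ugraph \<Rightarrow> bool" where
  "cycle_on n h C \<longleftrightarrow> 3 \<le> n \<and> bij_betw h {..<n} (verts C) \<and> edges C = cycle_edge n h ` {..<n}"

lemma graph_iso_cycle_on:
  assumes "graph_iso (cycle_graph n) C" "3 \<le> n"
  obtains h where "cycle_on n h C"
proof -
  from assms(1) obtain h where h: "bij_betw h {..<n} (verts C)"
    "edges C = (\<lambda>e. h ` e) ` {{i, Suc i mod n} | i. i < n}"
    by (auto simp: graph_iso_def cycle_graph_def)
  have "{{i, Suc i mod n} | i. i < n} = (\<lambda>i. {i, Suc i mod n}) ` {..<n}" by blast
  then have "edges C = cycle_edge n h ` {..<n}"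
    by (simp add: h(2) image_image cycle_edge_def)
  with h(1) assms(2) have "cycle_on n h C" by (simp add: cycle_on_def)
  then show ?thesis by (rule that)
qed

lemma Suc_mod_neq:
  assumes "2 \<le> n" "i < n"
  shows "Suc i mod n \<noteq> i"
  using assms by (auto simp: mod_Suc split: if_splits)

text \<open>Two different indices with the same edge would be cyclic successors of each other, so
  \<open>n\<close> would divide \<open>2\<close>.\<close>

lemma cycle_edge_inj:
  assumes "inj_on h {..<n}" "3 \<le> n"
  shows "inj_on (cycle_edge n h) {..<n}"
proof (rule inj_onI)
  fix i j assume ij: "i \<in> {..<n}" "j \<in> {..<n}" and eq: "cycle_edge n h i = cycle_edge n h j"
  have mod: "Suc i mod n \<in> {..<n}" "Suc j mod n \<in> {..<n}" using assms(2) by auto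
  show "i = j"
  proof (rule ccontr)
    assume "i \<noteq> j"
    then have "h i = h (Suc j mod n)" "h j = h (Suc i mod n)"
      using eq ij assms(1) by (auto simp: cycle_edge_def doubleton_eq_iff inj_on_eq_iff)
    then have eqs: "i = Suc j mod n" "j = Suc i mod n"
      using ij mod assms(1) by (auto simp: inj_on_eq_iff)
    have step: "Suc a mod n = 0 \<and> Suc a = n \<or> Suc a mod n = Suc a" if "a < n" for a
      using that by (cases "Suc a = n") auto
    from step[of i] step[of j] show False using assms(2) ij unfolding eqs[symmetric] by auto
  qed
qed

lemma simple_graph_cycle_on:
  assumes "cycle_on n h C"
  shows "simple_graph C"
proof -
  have "card (cycle_edge n h i) = 2" if "i < n" for i
  proof -
    have "h i \<noteq> h (Suc i mod n)"
      using that assms Suc_mod_neq[of n i] by (auto simp: cycle_on_def bij_betw_def inj_on_eq_iff)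
    then show ?thesis by (simp add: cycle_edge_def)
  qed
  moreover have "cycle_edge n h i \<subseteq> verts C" if "i < n" for i
    using that assms by (auto simp: cycle_on_def cycle_edge_def bij_betw_def)
  moreover have "finite (verts C)"
    using assms by (auto simp: cycle_on_def dest: bij_betw_finite)
  ultimately show ?thesis
    using assms by (auto simp: simple_graph_def cycle_on_def)
qed

lemma graph_order_cycle_on: "cycle_on n h C \<Longrightarrow> graph_order C = n"
  by (auto simp: cycle_on_def graph_order_def dest: bij_betw_same_card)

text \<open>The index \<open>(j + n - 1) mod n\<close> is the cyclic predecessor of
  \<open>j\<close>, written so that subtraction does not truncate at \<open>j = 0\<close>.\<close>

lemma vertex_sum_cycle_on:
  assumes C: "cycle_on n h C" and j: "j < n"
  shows "vertex_sum C f (h j) = f (cycle_edge n h j) + f (cycle_edge n h ((j + n - 1) mod n))"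
proof -
  let ?j' = "(j + n - 1) mod n"
  have n: "3 \<le> n" and inj: "inj_on h {..<n}" and E: "edges C = cycle_edge n h ` {..<n}"
    using C by (auto simp: cycle_on_def bij_betw_def)
  have j': "?j' < n" using n by simp
  have pred: "Suc i mod n = j \<longleftrightarrow> i = ?j'" if "i < n" for i
    using that j n by (cases j) (auto simp: mod_Suc split: if_splits)
  have "h j \<in> cycle_edge n h i \<longleftrightarrow> i = j \<or> i = ?j'" if "i < n" for i
  proof -
    have "Suc i mod n < n" using n by simp
    then have "h j \<in> cycle_edge n h i \<longleftrightarrow> j = i \<or> j = Suc i mod n"
      using inj j that by (auto simp: cycle_edge_def inj_on_eq_iff)
    then show ?thesis using pred[OF that] by auto
  qed
  then have eq: "{e. e \<in> edges C \<and> h j \<in> e} = {cycle_edge n h j, cycle_edge n h ?j'}"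
    using j j' by (auto simp: E)
  have "?j' \<noteq> j" using pred[OF j] Suc_mod_neq[of n j] j n by auto
  then have "cycle_edge n h j \<noteq> cycle_edge n h ?j'"
    using cycle_edge_inj[OF inj n] j j' by (metis inj_onD lessThan_iff)
  then show ?thesis by (simp add: vertex_sum_def eq)
qed

lemma regular_graph_cycle_on:
  assumes "cycle_on n h C"
  shows "regular_graph 2 C"
proof -
  have "verts C = h ` {..<n}" using assms by (simp add: cycle_on_def bij_betw_def)
  then show ?thesis
    using vertex_sum_cycle_on[OF assms, of _ "\<lambda>_. 1"]
    by (auto simp: regular_graph_def graph_degree_vertex_sum)
qed

text \<open>With only two colours the colours alternate along the cycle; for odd \<open>n\<close>
  the adjacent vertices \<open>n - 1\<close> and \<open>0\<close> would then agree. The colours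
  actually used are counted, since such counts add up over a join.\<close>

lemma cycle_on_colors:
  assumes C: "cycle_on n h C" and c: "proper_coloring C c"
  shows "(if even n then 2 else 3) \<le> card (c ` verts C)"
proof -
  define b where "b i = c (h i)" for i
  have n: "3 \<le> n" and V: "verts C = h ` {..<n}"
    using C by (auto simp: cycle_on_def bij_betw_def)
  then have fin: "finite (verts C)" by simp
  have im: "c ` verts C = b ` {..<n}" by (auto simp: V b_def)
  have adj: "b i \<noteq> b (Suc i mod n)" if "i < n" for i
    using c C that by (auto simp: proper_coloring_def cycle_on_def cycle_edge_def b_def)
  have b01: "b 0 \<noteq> b 1" using adj[of 0] n by simp
  have two: "{b 0, b 1} \<subseteq> c ` verts C" using n by (auto simp: im)
  then have "2 \<le> card (c ` verts C)"
    using b01 card_mono[OF _ two] fin by simp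
  moreover have "3 \<le> card (c ` verts C)" if "odd n"
  proof (rule ccontr)
    assume "\<not> 3 \<le> card (c ` verts C)"
    then have "card (c ` verts C) \<le> card {b 0, b 1}" using b01 by simp
    then have eq: "c ` verts C = {b 0, b 1}"
      using two fin by (metis card_seteq finite_imageI)
    have val: "b i \<in> {b 0, b 1}" if "i < n" for i
      using that eq im by auto
    have "i < n \<Longrightarrow> b i = (if even i then b 0 else b 1)" for i
    proof (induction i)
      case (Suc i)
      then have "b (Suc i) \<noteq> b i" using adj[of i] by auto
      then show ?case using Suc val[of "Suc i"] by (auto split: if_splits)
    qed simp
    from this[of "n - 1"] have "b (n - 1) = b 0" using \<open>odd n\<close> n by simp
    then show False using adj[of "n - 1"] n by simp
  qed
  ultimately show ?thesis by simp
qed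

section \<open>Labeling the join with a cycle\<close>

text \<open>Up to a constant independent of \<open>j\<close>, this is the colour of the
  \<open>j\<close>-th cycle vertex in the join.\<close>

definition column_sum :: "'r set \<Rightarrow> nat \<Rightarrow> ('r \<Rightarrow> nat \<Rightarrow> int) \<Rightarrow> (nat \<Rightarrow> int) \<Rightarrow> nat \<Rightarrow> int" where
  "column_sum I n M X j = (\<Sum>c\<in>I. M c j) + X j + X ((j + n - 1) mod n)"

text \<open>\<open>M c j\<close> is the label, counted from \<open>0\<close>, of the edge joining the \<open>c\<close>-th vertex of the old graph
  to the \<open>j\<close>-th cycle vertex, and \<open>X j\<close> that of the cycle edge from vertex \<open>j\<close> to vertex
  \<open>j + 1\<close>. Since old and new vertices have the same degree in the join, and only the old ones meet
  the small labels of the old graph, the bound by the common row sum \<open>R\<close> keeps their sums apart.\<close>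

definition label_array :: "'r set \<Rightarrow> nat \<Rightarrow> nat \<Rightarrow> ('r \<Rightarrow> nat \<Rightarrow> int) \<Rightarrow> (nat \<Rightarrow> int) \<Rightarrow> bool" where
  "label_array I n t M X \<longleftrightarrow> finite I
     \<and> inj_on (\<lambda>(c, j). M c j) (I \<times> {..<n}) \<and> inj_on X {..<n}
     \<and> (\<forall>c\<in>I. \<forall>j<n. M c j \<in> {0..<int ((card I + 1) * n)} - X ` {..<n})
     \<and> X ` {..<n} \<subseteq> {0..<int ((card I + 1) * n)}
     \<and> (\<exists>R. (\<forall>c\<in>I. (\<Sum>j<n. M c j) = R) \<and> (\<forall>j<n. R \<le> column_sum I n M X j))
     \<and> (\<forall>j<n. column_sum I n M X j \<noteq> column_sum I n M X (Suc j mod n))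
     \<and> card (column_sum I n M X ` {..<n}) \<le> t"

text \<open>The last premise has the shape of the conclusion of \<open>odd_columns\<close>, which
  supplies it for odd cycles.\<close>

lemma label_arrayI:
  assumes "finite I" "inj_on (\<lambda>(c, j). M c j) (I \<times> {..<n})" "inj_on X {..<n}"
    and "W = int ((card I + 1) * n)"
    and "\<And>c j. c \<in> I \<Longrightarrow> j < n \<Longrightarrow> 0 \<le> M c j" "\<And>c j. c \<in> I \<Longrightarrow> j < n \<Longrightarrow> M c j < W"
    and "\<And>c j i. c \<in> I \<Longrightarrow> j < n \<Longrightarrow> i < n \<Longrightarrow> M c j \<noteq> X i"
    and "\<And>j. j < n \<Longrightarrow> 0 \<le> X j" "\<And>j. j < n \<Longrightarrow> X j < W"
    and "\<And>c. c \<in> I \<Longrightarrow> (\<Sum>j<n. M c j) = R"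
    and "(\<forall>j<n. R \<le> column_sum I n M X j) \<and>
      (\<forall>j<n. column_sum I n M X j \<noteq> column_sum I n M X (Suc j mod n)) \<and>
      card (column_sum I n M X ` {..<n}) \<le> t"
  shows "label_array I n t M X"
  unfolding label_array_def assms(4)[symmetric] using assms(1-3,5-) by (auto simp: image_subset_iff)

text \<open>The labels \<open>1..q\<close> stay on \<open>G\<close> and the array, shifted by
  \<open>q + 1\<close>, fills the rest. Equal row sums translate all colours of \<open>G\<close> by
  one constant, so only the colours of the columns are new. The equation between \<open>d\<close>,
  \<open>n\<close> and the order says that old and new vertices have equal degree in the
  join.\<close>

lemma join_cycle_labeling:
  fixes G C :: "'a ugraph" and M :: "'r \<Rightarrow> nat \<Rightarrow> int"
  assumes G: "simple_graph G" "regular_graph d G" "1 \<le> d"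
    and f: "local_antimagic G f"
    and C: "cycle_on n h C" and disj: "verts G \<inter> verts C = {}"
    and I: "card I = graph_order G" "d + n = graph_order G + 2"
    and A: "label_array I n t M X"
  obtains F where "local_antimagic (graph_join G C) F"
    and "card (vertex_sum (graph_join G C) F ` verts (graph_join G C))
           \<le> card (vertex_sum G f ` verts G) + t"
proof -
  let ?J = "graph_join G C"
  define q where "q = card (edges G)"
  have simC: "simple_graph C" using C by (rule simple_graph_cycle_on)
  have simJ: "simple_graph ?J" using G(1) simC disj by (rule simple_graph_join)
  have finI: "finite I" using A by (simp add: label_array_def)
  have finG: "finite (verts G)" using G by (simp add: simple_graph_def)
  have n: "3 \<le> n" and h: "bij_betw h {..<n} (verts C)" and EC: "edges C = cycle_edge n h ` {..<n}"
    using C by (auto simp: cycle_on_def)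
  have hinj: "inj_on h {..<n}" and VC: "verts C = h ` {..<n}" using h by (auto simp: bij_betw_def)
  obtain \<gamma> where \<gamma>: "bij_betw \<gamma> I (verts G)"
    using finI finG I(1) by (metis finite_same_card_bij graph_order_def)
  then have \<gamma>inj: "inj_on \<gamma> I" and VG: "verts G = \<gamma> ` I" by (auto simp: bij_betw_def)
  let ?P = "I \<times> {..<n}"
  define cross where "cross = (\<lambda>(c, j). {\<gamma> c, h j})"
  have sep: "\<gamma> c \<noteq> h j" if "c \<in> I" "j < n" for c j
    using that disj VG VC by auto
  have crossinj: "inj_on cross ?P"
    using \<gamma>inj hinj sep by (auto simp: inj_on_def cross_def doubleton_eq_iff)
  have cyinj: "inj_on (cycle_edge n h) {..<n}" using hinj n by (rule cycle_edge_inj)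
  have EJ: "edges ?J = edges G \<union> edges C \<union> cross ` ?P"
    by (auto simp: graph_join_def cross_def VG VC)
  have GC: "edges G \<inter> edges C = {}"
  proof -
    have "e \<notin> edges C" if "e \<in> edges G" for e
    proof
      assume "e \<in> edges C"
      then obtain u v where "e = {u, v}" "u \<in> verts C" using simple_graph_edgeE[OF simC] by metis
      then show False using simple_graph_edge_verts[OF G(1) that] disj by auto
    qed
    then show ?thesis by blast
  qed
  have notG: "cross x \<notin> edges G" and notC: "cross x \<notin> edges C" if "x \<in> ?P" for x
  proof -
    obtain c j where x: "x = (c, j)" "c \<in> I" "j < n" using \<open>x \<in> ?P\<close> by auto
    then have "\<gamma> c \<in> verts G" "h j \<in> verts C" by (auto simp: VG VC)
    then show "cross x \<notin> edges G" "cross x \<notin> edges C"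
      using simple_graph_edge_verts[OF G(1), of "cross x"] simple_graph_edge_verts[OF simC, of "cross x"] disj
      by (auto simp: cross_def x)
  qed
  define F where "F e = (if e \<in> edges G then f e
      else if e \<in> edges C then q + 1 + nat (X (the_inv_into {..<n} (cycle_edge n h) e))
      else q + 1 + nat (case_prod M (the_inv_into ?P cross e)))" for e
  have FG: "F e = f e" if "e \<in> edges G" for e using that by (simp add: F_def)
  have FC: "F (cycle_edge n h i) = q + 1 + nat (X i)" if "i < n" for i
  proof -
    have "cycle_edge n h i \<in> edges C" using that EC by auto
    then show ?thesis using that GC the_inv_into_f_f[OF cyinj, of i] by (auto simp: F_def)
  qed
  have FX: "F (cross x) = q + 1 + nat (case_prod M x)" if "x \<in> ?P" for x
    using that notG notC the_inv_into_f_f[OF crossinj, of x] by (auto simp: F_def)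
  let ?W = "int ((card I + 1) * n)"
  have Mrange: "0 \<le> M c j" "M c j < ?W" "M c j \<noteq> X i" if "c \<in> I" "j < n" "i < n" for c j i
    using A that by (auto simp: label_array_def)
  have Xrange: "0 \<le> X i" "X i < ?W" if "i < n" for i
    using A that by (auto simp: label_array_def image_subset_iff)
  have Minj: "inj_on (\<lambda>(c, j). M c j) ?P" and Xinj: "inj_on X {..<n}"
    using A by (simp_all add: label_array_def)
  have fbij: "bij_betw f (edges G) {1..q}"
    using f by (simp add: local_antimagic_def q_def)
  have frange: "1 \<le> f e" "f e \<le> q" if "e \<in> edges G" for e
    using fbij that by (auto simp: bij_betw_def)

  have cardJ: "card (edges ?J) = q + (card I + 1) * n"
  proof -
    have "card (edges ?J) = card (edges G \<union> edges C) + card (cross ` ?P)"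
      unfolding EJ using notG notC simple_graph_finite_edges[OF G(1)] simple_graph_finite_edges[OF simC] finI
      by (intro card_Un_disjoint) auto
    also have "card (edges G \<union> edges C) = q + card (edges C)"
      using GC simple_graph_finite_edges[OF G(1)] simple_graph_finite_edges[OF simC]
      by (simp add: card_Un_disjoint q_def)
    also have "card (edges C) = n" using card_image[OF cyinj] EC by simp
    also have "card (cross ` ?P) = card I * n" using card_image[OF crossinj] by (simp add: card_cartesian_product)
    finally show ?thesis by simp
  qed
  have Finj: "inj_on F (edges ?J)"
  proof -
    have "inj_on F (edges G)"
      using fbij by (auto simp: FG bij_betw_def inj_on_def)
    moreover have "inj_on F (edges C)"
    proof (rule inj_onI)
      fix e e' assume "e \<in> edges C" "e' \<in> edges C" "F e = F e'"
      then obtain i i' where i: "i < n" "i' < n" "e = cycle_edge n h i" "e' = cycle_edge n h i'"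
        and "nat (X i) = nat (X i')"
        using EC FC by auto
      then have "X i = X i'" using Xrange by (metis nat_eq_iff2)
      then show "e = e'" using Xinj i by (auto simp: inj_on_def)
    qed
    moreover have "inj_on F (cross ` ?P)"
    proof (rule inj_onI)
      fix e e' assume "e \<in> cross ` ?P" "e' \<in> cross ` ?P" "F e = F e'"
      then obtain x x' where x: "x \<in> ?P" "x' \<in> ?P" "e = cross x" "e' = cross x'"
        and eq: "nat (case_prod M x) = nat (case_prod M x')"
        using FX by auto
      have "0 \<le> case_prod M x" "0 \<le> case_prod M x'" using x(1,2) Mrange(1) by auto
      then have "case_prod M x = case_prod M x'" using eq by simp
      then show "e = e'" using Minj x by (auto simp: inj_on_def)
    qed
    moreover have "F e \<noteq> F e'" if "e \<in> edges G" "e' \<in> edges C \<union> cross ` ?P" for e e'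
    proof -
      have "F e \<le> q" using that(1) frange FG by auto
      moreover have "q < F e'" using that(2) FC FX EC by auto
      ultimately show ?thesis by simp
    qed
    moreover have "F e \<noteq> F e'" if e: "e \<in> edges C" "e' \<in> cross ` ?P" for e e'
    proof -
      obtain i where i: "i < n" "e = cycle_edge n h i" using e(1) EC by auto
      obtain c j where x: "c \<in> I" "j < n" "e' = cross (c, j)" using e(2) by auto
      have "F e = q + 1 + nat (X i)" "F e' = q + 1 + nat (M c j)"
        using FC[OF i(1)] FX[of "(c, j)"] i x by auto
      then show ?thesis using Mrange[OF x(1,2) i(1)] Xrange[OF i(1)] by auto
    qed
    ultimately show ?thesis
      unfolding EJ inj_on_def by (metis UnE UnI1 UnI2)
  qed
  have Fsub: "F ` edges ?J \<subseteq> {1..card (edges ?J)}"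
  proof -
    have "F e \<in> {1..q + (card I + 1) * n}" if e: "e \<in> edges ?J" for e
    proof -
      consider "e \<in> edges G" | i where "i < n" "e = cycle_edge n h i"
        | c j where "c \<in> I" "j < n" "e = cross (c, j)"
        using e EJ EC by auto
      then show ?thesis
      proof cases
        case 1
        then show ?thesis using frange[OF 1] FG[OF 1] by simp
      next
        case 2
        have "nat (X i) < (card I + 1) * n" using Xrange[OF 2(1)] by (simp add: nat_less_iff)
        then show ?thesis using 2 FC by auto
      next
        case 3
        have "nat (M c j) < (card I + 1) * n"
          using Mrange[OF 3(1,2,2)] by (simp add: nat_less_iff)
        then show ?thesis using 3 FX[of "(c, j)"] by auto
      qed
    qed
    then show ?thesis unfolding cardJ by blast
  qed
  \<comment> \<open>An injection into a finite set of the same cardinality is onto.\<close>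
  have Fbij: "bij_betw F (edges ?J) {1..card (edges ?J)}"
    unfolding bij_betw_def using Finj Fsub
    by (metis card_atLeastAtMost card_image card_subset_eq diff_Suc_1 finite_atLeastAtMost)

  obtain R where R: "\<And>c. c \<in> I \<Longrightarrow> (\<Sum>j<n. M c j) = R"
    "\<And>j. j < n \<Longrightarrow> R \<le> column_sum I n M X j"
    using A by (auto simp: label_array_def)
  have sumG: "int (vertex_sum ?J F (\<gamma> c)) = int (vertex_sum G f (\<gamma> c)) + (int n * (int q + 1) + R)"
    if c: "c \<in> I" for c
  proof -
    have "vertex_sum ?J F (\<gamma> c) = vertex_sum G F (\<gamma> c) + (\<Sum>w\<in>verts C. F {\<gamma> c, w})"
      using vertex_sum_join[OF G(1) simC disj] c VG by auto
    also have "vertex_sum G F (\<gamma> c) = vertex_sum G f (\<gamma> c)"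
      unfolding vertex_sum_def by (intro sum.cong) (auto simp: FG)
    also have "(\<Sum>w\<in>verts C. F {\<gamma> c, w}) = (\<Sum>j<n. F {\<gamma> c, h j})"
      by (rule sum.reindex_bij_betw[OF h, symmetric])
    also have "\<dots> = (\<Sum>j<n. q + 1 + nat (M c j))"
      using FX[of "(c, _)"] c by (intro sum.cong) (auto simp: cross_def)
    finally have "int (vertex_sum ?J F (\<gamma> c))
        = int (vertex_sum G f (\<gamma> c)) + (\<Sum>j<n. int q + 1 + M c j)"
      using Mrange(1)[OF c] by (simp add: add_ac)
    also have "(\<Sum>j<n. int q + 1 + M c j) = int n * (int q + 1) + R"
      by (simp only: sum.distrib R(1)[OF c]) (simp add: algebra_simps)
    finally show ?thesis .
  qed
  have sumC: "int (vertex_sum ?J F (h j)) = column_sum I n M X j + (int d + int n) * (int q + 1)"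
    if j: "j < n" for j
  proof -
    have j': "(j + n - 1) mod n < n" using n by simp
    have disj': "verts C \<inter> verts G = {}" using disj by blast
    have "vertex_sum ?J F (h j) = vertex_sum C F (h j) + (\<Sum>w\<in>verts G. F {h j, w})"
      using vertex_sum_join[OF simC G(1) disj'] j VC by (auto simp: graph_join_commute[of G])
    also have "vertex_sum C F (h j) = q + 1 + nat (X j) + (q + 1 + nat (X ((j + n - 1) mod n)))"
      using vertex_sum_cycle_on[OF C j] FC[OF j] FC[OF j'] by simp
    also have "(\<Sum>w\<in>verts G. F {h j, w}) = (\<Sum>c\<in>I. F {h j, \<gamma> c})"
      by (rule sum.reindex_bij_betw[OF \<gamma>, symmetric])
    also have "\<dots> = (\<Sum>c\<in>I. q + 1 + nat (M c j))"
      using FX[of "(_, j)"] j by (intro sum.cong) (auto simp: cross_def insert_commute)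
    finally have "int (vertex_sum ?J F (h j))
        = 2 * (int q + 1) + X j + X ((j + n - 1) mod n) + (\<Sum>c\<in>I. int q + 1 + M c j)"
      using Mrange(1)[OF _ j] Xrange(1)[OF j] Xrange(1)[OF j'] j by (simp add: add_ac)
    also have "\<dots> = column_sum I n M X j + (2 + int (card I)) * (int q + 1)"
      by (simp only: sum.distrib column_sum_def) (simp add: algebra_simps)
    also have "2 + int (card I) = int d + int n" using I by simp
    finally show ?thesis .
  qed
  \<comment> \<open>At an old vertex the \<open>d\<close> old labels add up to at most
    \<open>d * q\<close>, whereas the common constant at a cycle vertex allots
    \<open>d * (q + 1)\<close> in their place. Since \<open>d \<ge> 1\<close>, the inequality is
    strict.\<close>
  have sepGC: "vertex_sum ?J F (\<gamma> c) < vertex_sum ?J F (h j)" if "c \<in> I" "j < n" for c j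
  proof -
    have v: "\<gamma> c \<in> verts G" using that VG by auto
    have "vertex_sum G f (\<gamma> c) \<le> (\<Sum>e | e \<in> edges G \<and> \<gamma> c \<in> e. q)"
      unfolding vertex_sum_def using frange(2) by (intro sum_mono) auto
    also have "\<dots> = d * q"
      using G(2) v by (simp add: regular_graph_def graph_degree_def)
    finally have "int (vertex_sum G f (\<gamma> c)) \<le> int d * int q" by (metis of_nat_le_iff of_nat_mult)
    then show ?thesis
      using sumG[OF that(1)] sumC[OF that(2)] R(2)[OF that(2)] G(3) by (simp add: algebra_simps)
  qed
  have colne: "vertex_sum ?J F (h j) \<noteq> vertex_sum ?J F (h (Suc j mod n))" if "j < n" for j
  proof -
    have "Suc j mod n < n" using n by simp
    then show ?thesis
      using sumC[OF that] sumC[of "Suc j mod n"] A that by (auto simp: label_array_def)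
  qed
  have "vertex_sum ?J F u \<noteq> vertex_sum ?J F v" if uv: "{u, v} \<in> edges ?J" for u v
  proof -
    consider "{u, v} \<in> edges G" | i where "i < n" "{u, v} = cycle_edge n h i"
      | c j where "c \<in> I" "j < n" "{u, v} = cross (c, j)"
      using uv EJ EC by auto
    then show ?thesis
    proof cases
      case 1
      then have "u \<in> verts G" "v \<in> verts G" using simple_graph_edge_verts[OF G(1) 1] by auto
      then obtain a b where ab: "u = \<gamma> a" "a \<in> I" "v = \<gamma> b" "b \<in> I" by (auto simp: VG)
      have "vertex_sum G f u \<noteq> vertex_sum G f v" using 1 f by (auto simp: local_antimagic_def)
      then show ?thesis using sumG[OF ab(2)] sumG[OF ab(4)] ab by auto
    next
      case 2
      then show ?thesis using colne[OF 2(1)] by (auto simp: cycle_edge_def doubleton_eq_iff)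
    next
      case 3
      then show ?thesis using sepGC[OF 3(1,2)] by (auto simp: cross_def doubleton_eq_iff)
    qed
  qed
  then have la: "local_antimagic ?J F" using Fbij by (auto simp: local_antimagic_def)

  \<comment> \<open>Each new colour is a function of the old one, so the number of colours on
    \<open>G\<close> cannot grow.\<close>
  have "vertex_sum ?J F ` verts G
      = (\<lambda>s. nat (int s + (int n * (int q + 1) + R))) ` vertex_sum G f ` verts G"
    unfolding VG image_image using sumG by (intro image_cong) (auto simp flip: sumG)
  then have cG: "card (vertex_sum ?J F ` verts G) \<le> card (vertex_sum G f ` verts G)"
    using finG by (simp add: card_image_le)
  have "vertex_sum ?J F ` verts C
      = (\<lambda>s. nat (s + (int d + int n) * (int q + 1))) ` column_sum I n M X ` {..<n}"
    unfolding VC image_image by (intro image_cong) (auto simp flip: sumC)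
  then have "card (vertex_sum ?J F ` verts C) \<le> card (column_sum I n M X ` {..<n})"
    by (simp add: card_image_le)
  also have "\<dots> \<le> t" using A by (simp add: label_array_def)
  finally have "card (vertex_sum ?J F ` verts ?J) \<le> card (vertex_sum G f ` verts G) + t"
    using cG card_Un_le[of "vertex_sum ?J F ` verts G" "vertex_sum ?J F ` verts C"]
    by (simp add: image_Un)
  with la show ?thesis by (rule that)
qed

section \<open>Arrays for even cycles\<close>

lemma sum_lessThan_double:
  "(\<Sum>j<2 * m. F j) = (\<Sum>i<m. F (2 * i) + F (Suc (2 * i)))" for F :: "nat \<Rightarrow> int"
  by (induction m) (auto simp: algebra_simps)

lemma sum_lessThan_rev: "(\<Sum>i<m. int m - 1 - int i) = (\<Sum>i<m. int i)"
proof -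
  have "(\<Sum>i<m. int m - 1 - int i) = (\<Sum>i<m. int (m - Suc i))"
    by (intro sum.cong) (auto simp: of_nat_diff)
  then show ?thesis using sum.nat_diff_reindex[of int m] by simp
qed

lemma double_sum_int_lessThan: "2 * (\<Sum>i<m. int i) = int m * (int m - 1)"
  by (induction m) (auto simp: algebra_simps)

text \<open>Uniqueness of quotient and remainder; it recovers block and position from a
  label.\<close>

lemma mult_add_eq_iff:
  fixes a a' b b' m :: int
  assumes "0 \<le> b" "b < m" "0 \<le> b'" "b' < m"
  shows "m * a + b = m * a' + b' \<longleftrightarrow> a = a' \<and> b = b'"
proof
  assume eq: "m * a + b = m * a' + b'"
  have "(m * a + b) div m = a" "(m * a' + b') div m = a'" using assms by auto
  then have "a = a'" using eq by simp
  then show "a = a' \<and> b = b'" using eq by simp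
qed simp

lemma inj_on_case_prodI:
  assumes "\<And>a b a' b'. a \<in> A \<Longrightarrow> b \<in> B \<Longrightarrow> a' \<in> A \<Longrightarrow> b' \<in> B \<Longrightarrow> f a b = f a' b' \<Longrightarrow> a = a' \<and> b = b'"
  shows "inj_on (\<lambda>(a, b). f a b) (A \<times> B)"
  using assms by (fastforce simp: inj_on_def)

text \<open>Cut the labels into blocks of length \<open>m\<close>. Row \<open>c\<close> takes two complementary blocks, one for the
  even and one for the odd columns, so its sum does not depend on the order inside the blocks. That
  order is free to cancel the cycle labels: row \<open>0\<close> cancels the edge \<open>2 * i\<close> of the cycle, row \<open>1\<close>
  cancels the odd-numbered edges, and the remaining rows cancel in pairs.\<close>

definition block :: "nat \<Rightarrow> nat \<Rightarrow> nat \<Rightarrow> int" where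
  "block s c j = (if even c \<longleftrightarrow> even j then int c else 4 * int s - 1 - int c)"

text \<open>The cycle edge entering an even vertex \<open>j\<close> is odd-numbered and has
  half-index \<open>(j div 2 + m - 1) mod m\<close>. Row \<open>1\<close> therefore needs a rotated
  order in the even columns.\<close>

definition offset :: "nat \<Rightarrow> nat \<Rightarrow> nat \<Rightarrow> int" where
  "offset m c j =
     (if c = 1 \<and> even j then int m - 1 - int ((j div 2 + m - 1) mod m)
      else if even c \<and> c \<noteq> 0 then int (j div 2)
      else int m - 1 - int (j div 2))"

lemma pred_mod: "i < m \<Longrightarrow> (i + m - Suc 0) mod m = (if i = 0 then m - 1 else i - 1)" for i m :: nat
  by (cases i) auto

lemma offset_range:
  assumes "j < 2 * m"
  shows "0 \<le> offset m c j" "offset m c j < int m"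
proof -
  have "j div 2 < m" using assms by auto
  moreover have "(j div 2 + m - 1) mod m < m" using assms by auto
  ultimately show "0 \<le> offset m c j" "offset m c j < int m"
    by (auto simp: offset_def)
qed

lemma offset_inj:
  assumes "j < 2 * m" "j' < 2 * m" "even j \<longleftrightarrow> even j'" "offset m c j = offset m c j'"
  shows "j = j'"
proof -
  have "j div 2 < m" "j' div 2 < m" using assms by auto
  then have "j div 2 = j' div 2"
    using assms(3,4) by (auto simp: offset_def pred_mod split: if_splits)
  then show ?thesis using assms(3) by (metis even_iff_mod_2_eq_zero mod_div_mult_eq not_mod_2_eq_1_eq_0 odd_iff_mod_2_eq_one)
qed

lemma block_range: "c < 2 * s \<Longrightarrow> 0 \<le> block s c j \<and> block s c j < 4 * int s"
  by (auto simp: block_def)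

text \<open>Where the parities of row and column agree the block is below \<open>2 * s\<close>,
  elsewhere it is at least \<open>2 * s\<close>; in both ranges it determines the row.\<close>

lemma block_inj:
  assumes "c < 2 * s" "c' < 2 * s" "block s c j = block s c' j'"
  shows "c = c' \<and> (even j \<longleftrightarrow> even j')"
  using assms by (auto simp: block_def split: if_splits)

lemma sum_block:
  "(\<Sum>c<2 * t. block s c j) = int t * (if even j then 4 * int s - 2 else 4 * int s)"
  by (induction t) (auto simp: block_def algebra_simps)

lemma sum_offset_rows:
  "(\<Sum>c<2 * Suc t. offset m c j) = offset m 0 j + offset m 1 j + int t * (int m - 1)"
  by (induction t) (auto simp: offset_def algebra_simps)

text \<open>Over the columns of one parity the offsets of a row are a permutation of
  \<open>0..m-1\<close>. Only the rotated order in row \<open>1\<close> needs an argument.\<close>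

lemma sum_offset_columns:
  assumes "0 < m"
  shows "(\<Sum>i<m. offset m c (2 * i)) = (\<Sum>i<m. int i)"
    and "(\<Sum>i<m. offset m c (Suc (2 * i))) = (\<Sum>i<m. int i)"
proof -
  obtain l where l: "m = Suc l" using assms by (cases m) auto
  have "(\<Sum>i<m. int m - 1 - int ((i + m - 1) mod m)) = (\<Sum>i<m. int m - 1 - (if i = 0 then int m - 1 else int i - 1))"
    by (intro sum.cong) (auto simp: pred_mod of_nat_diff)
  also have "\<dots> = (\<Sum>i<l. int m - 1 - int i)"
    unfolding l sum.lessThan_Suc_shift by simp
  also have "\<dots> = (\<Sum>i<m. int m - 1 - int i)" by (simp add: l)
  finally have rot: "(\<Sum>i<m. int m - 1 - int ((i + m - 1) mod m)) = (\<Sum>i<m. int i)"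
    by (simp only: sum_lessThan_rev)
  show "(\<Sum>i<m. offset m c (2 * i)) = (\<Sum>i<m. int i)"
    by (cases "c = 1"; cases "c = 0"; cases "even c") (simp_all add: offset_def rot sum_lessThan_rev del: One_nat_def)
  show "(\<Sum>i<m. offset m c (Suc (2 * i))) = (\<Sum>i<m. int i)"
    by (cases "c = 0"; cases "even c") (simp_all add: offset_def sum_lessThan_rev)
qed

text \<open>Join edges use the blocks below \<open>4 * s\<close>; the blocks \<open>4 * s\<close>
  and \<open>4 * s + 1\<close> go to the even- and odd-numbered cycle edges. Once the offsets
  cancel, a column sum depends only on the parity of the column.\<close>

lemma label_array_even:
  assumes "1 \<le> m" "m \<le> s"
  shows "label_array {..<2 * s} (2 * m) 2
    (\<lambda>c j. int m * block s c j + offset m c j)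
    (\<lambda>j. int m * (4 * int s + int (j mod 2)) + int (j div 2))"
    (is "label_array ?I ?n 2 ?M ?X")
proof -
  define E where "E = int m * (4 * int s * int s + 6 * int s + 1) + (int s + 1) * (int m - 1)"
  define O' where "O' = int m * (4 * int s * int s + 8 * int s + 1) + (int s + 1) * (int m - 1)"
  let ?S = "column_sum ?I ?n ?M ?X"
  obtain t where t: "s = Suc t" using assms by (cases s) auto
  have sumM: "(\<Sum>c\<in>?I. ?M c j) = int m * (int s * (if even j then 4 * int s - 2 else 4 * int s))
      + (offset m 0 j + offset m 1 j + (int s - 1) * (int m - 1))" for j
  proof -
    have "(\<Sum>c\<in>?I. ?M c j) = int m * (\<Sum>c<2 * s. block s c j) + (\<Sum>c<2 * s. offset m c j)"
      by (simp add: sum.distrib sum_distrib_left)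
    also have "(\<Sum>c<2 * s. offset m c j) = offset m 0 j + offset m 1 j + (int s - 1) * (int m - 1)"
      unfolding t sum_offset_rows by simp
    finally show ?thesis by (simp only: sum_block)
  qed
  have SE: "?S (2 * i) = E" if i: "i < m" for i
  proof -
    have "(2 * i + ?n - 1) mod ?n = Suc (2 * ((i + m - 1) mod m))"
      using i pred_mod[of "2 * i" ?n] pred_mod[of i m] by auto
    then show ?thesis
      unfolding column_sum_def sumM E_def by (simp add: offset_def algebra_simps)
  qed
  have SO: "?S (Suc (2 * i)) = O'" if i: "i < m" for i
  proof -
    have "(Suc (2 * i) + ?n - 1) mod ?n = 2 * i" using i by simp
    moreover have "Suc (2 * i) mod 2 = 1" "Suc (2 * i) div 2 = i" by auto
    ultimately show ?thesis
      unfolding column_sum_def sumM O'_def by (simp add: offset_def distrib_left distrib_right left_diff_distrib right_diff_distrib)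
  qed
  have S: "?S j = (if even j then E else O')" if "j < ?n" for j
    using that SE[of "j div 2"] SO[of "j div 2"] by (cases "even j") auto
  have EO: "E < O'" using assms by (simp add: E_def O'_def)
  have inj: "inj_on (\<lambda>(c, j). ?M c j) (?I \<times> {..<?n})"
  proof (rule inj_on_case_prodI)
    fix c j c' j' assume *: "c \<in> ?I" "j \<in> {..<?n}" "c' \<in> ?I" "j' \<in> {..<?n}" "?M c j = ?M c' j'"
    then have "block s c j = block s c' j' \<and> offset m c j = offset m c' j'"
      using offset_range by (simp add: mult_add_eq_iff)
    then show "c = c' \<and> j = j'" using block_inj[of c s c' j j'] offset_inj[of j m j' c] * by auto
  qed
  have Xinj: "inj_on ?X {..<?n}"
  proof (rule inj_onI)
    fix j j' assume *: "j \<in> {..<?n}" "j' \<in> {..<?n}" "?X j = ?X j'"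
    have "j div 2 < m" "j' div 2 < m" using * by auto
    then have "j mod 2 = j' mod 2 \<and> j div 2 = j' div 2"
      using *(3) mult_add_eq_iff[of "int (j div 2)" "int m" "int (j' div 2)"] by auto
    then show "j = j'" by (metis div_mult_mod_eq)
  qed
  have Xrange: "int m * (4 * int s) \<le> ?X j" "?X j < int m * (4 * int s + 2)" if "j < ?n" for j
  proof -
    have "j div 2 < m" "j mod 2 = 0 \<or> j mod 2 = 1" using that by auto
    then show "int m * (4 * int s) \<le> ?X j" "?X j < int m * (4 * int s + 2)"
      by (auto simp: algebra_simps)
  qed
  have Mrange: "0 \<le> ?M c j" "?M c j < int m * (4 * int s)" if "c < 2 * s" "j < ?n" for c j
  proof -
    note b = block_range[OF that(1), of j] and o = offset_range[OF that(2), of c]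
    show "0 \<le> ?M c j" using b o by simp
    have "int m * block s c j \<le> int m * (4 * int s - 1)" using b by (intro mult_left_mono) auto
    then show "?M c j < int m * (4 * int s)" using o by (simp add: algebra_simps)
  qed
  define R where "R = int m * (int m * (4 * int s - 1)) + 2 * (\<Sum>i<m. int i)"
  have row: "(\<Sum>j<?n. ?M c j) = R" if "c < 2 * s" for c
  proof -
    have eq: "block s c (2 * i) = 4 * int s - 1 - block s c (Suc (2 * i))" for i by (simp add: block_def)
    have "(\<Sum>j<?n. ?M c j) = (\<Sum>i<m. int m * (4 * int s - 1) + (offset m c (2 * i) + offset m c (Suc (2 * i))))"
      unfolding sum_lessThan_double by (intro sum.cong refl, simp only: eq) (simp add: algebra_simps)
    also have "\<dots> = R"
      using assms by (simp add: sum.distrib sum_offset_columns R_def)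
    finally show ?thesis .
  qed
  have RE: "R \<le> E"
  proof -
    \<comment> \<open>Naming the monomials makes the comparison linear; \<open>y \<le> x\<close> is
      an instance of \<open>m \<le> s\<close>.\<close>
    define x y z where "x = int m * (int s * int s)" "y = int m * (int m * int s)" "z = int m * int s"
    have "y \<le> x"
      unfolding x_y_z_def using assms by (intro mult_left_mono mult_right_mono) auto
    moreover have "int s \<le> z"
      unfolding x_y_z_def using assms mult_right_mono[of 1 "int m" "int s"] by simp
    moreover have "E - R = 4 * x - 4 * y + 7 * z - int s + 3 * int m - 1"
      unfolding R_def double_sum_int_lessThan E_def x_y_z_def by (simp add: algebra_simps)
    moreover have "1 \<le> int m" "int m \<le> int s" using assms by auto
    ultimately show ?thesis by linarith
  qed
  \<comment> \<open>The cycle length is even, so the parity flips at the wrap-around too.\<close>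
  have par: "even (Suc j mod ?n) \<longleftrightarrow> odd j" if "j < ?n" for j
    using that by (auto simp: mod_Suc) presburger
  have "?S ` {..<?n} \<subseteq> {E, O'}" using S by auto
  then have "card (?S ` {..<?n}) \<le> card {E, O'}" by (intro card_mono) auto
  then have card: "card (?S ` {..<?n}) \<le> 2" using EO by simp
  have W: "int ((card ?I + 1) * ?n) = int m * (4 * int s + 2)" by (simp add: algebra_simps)
  have ne: "?M c j \<noteq> ?X i" if "c < 2 * s" "j < ?n" "i < ?n" for c j i
    using Mrange(2)[OF that(1,2)] Xrange(1)[OF that(3)] by linarith
  have Mrange': "?M c j < int m * (4 * int s + 2)" if "c < 2 * s" "j < ?n" for c j
    using Mrange(2)[OF that] assms by (simp add: algebra_simps)
  have Xrange': "0 \<le> ?X j" for j by simp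
  have RS: "\<forall>j<?n. R \<le> ?S j" using S RE EO by auto
  have Sne: "\<forall>j<?n. ?S j \<noteq> ?S (Suc j mod ?n)"
  proof (intro allI impI)
    fix j assume j: "j < ?n"
    then have "Suc j mod ?n < ?n" by simp
    then show "?S j \<noteq> ?S (Suc j mod ?n)" using S[OF j] S[of "Suc j mod ?n"] par[OF j] EO by auto
  qed
  show ?thesis
    unfolding label_array_def W
    using inj Xinj card RS Sne row by (auto simp: Mrange Mrange' ne Xrange Xrange')
qed

section \<open>Arrays for odd cycles\<close>

text \<open>For \<open>n = 2 * m + 1\<close> use labels \<open>(2 * g + 1) * k + g + l\<close> with \<open>k \<le> 2 * m\<close> and
  \<open>\<bar>l\<bar> \<le> g\<close>. Row \<open>c\<close> meets every \<open>k\<close> once, with residues \<open>c\<close>, \<open>shift g c\<close> or \<open>- shift g c\<close> that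
  add up to \<open>0\<close>; the cyclic shift is chosen so that \<open>- shift g c - c\<close>, the residue at \<open>k = 0\<close>, is
  again a permutation of \<open>{- g..g}\<close>. Vertex \<open>0\<close> of the cycle is a colour class of its own, hence
  column \<open>0\<close> is unconstrained and absorbs \<open>k = 2 * m\<close>.\<close>

definition shift :: "nat \<Rightarrow> int \<Rightarrow> int" where
  "shift g c = (if c \<le> 0 then c + int g else c - int g - 1)"

definition grid_label :: "nat \<Rightarrow> nat \<Rightarrow> nat \<Rightarrow> int \<Rightarrow> int" where
  "grid_label g m k c = (2 * int g + 1) * int k + (int g +
     (if k = 2 * m then c else if m \<le> k then shift g c else - shift g c - (if k = 0 then c else 0)))"

lemma grid_label_residue_range:
  assumes "c \<in> {- int g..int g}"
  shows "0 \<le> int g + (if k = 2 * m then c else if m \<le> k then shift g c else - shift g c - (if k = 0 then c else 0))"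
    and "int g + (if k = 2 * m then c else if m \<le> k then shift g c else - shift g c - (if k = 0 then c else 0)) < 2 * int g + 1"
  using assms by (auto simp: shift_def)

text \<open>The quotient by \<open>2 * g + 1\<close> is \<open>k\<close>, and for fixed
  \<open>k\<close> the residue determines \<open>c\<close>. In the delicate case
  \<open>k = 0 < m\<close> the residues are \<open>- 2 * c - g\<close> for \<open>c \<le> 0\<close>
  and \<open>g + 1 - 2 * c\<close> for \<open>c > 0\<close>, which differ in parity.\<close>

lemma grid_label_inj:
  assumes "c \<in> {- int g..int g}" "c' \<in> {- int g..int g}"
    and "grid_label g m k c = grid_label g m k' c'"
  shows "k = k' \<and> c = c'"
proof -
  have "int k = int k' \<and>
      int g + (if k = 2 * m then c else if m \<le> k then shift g c else - shift g c - (if k = 0 then c else 0)) =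
      int g + (if k' = 2 * m then c' else if m \<le> k' then shift g c' else - shift g c' - (if k' = 0 then c' else 0))"
    using assms(3) grid_label_residue_range[OF assms(1), of k m] grid_label_residue_range[OF assms(2), of k' m]
    unfolding grid_label_def by (subst (asm) mult_add_eq_iff) auto
  then show ?thesis
    using assms(1,2) by (auto simp: shift_def split: if_splits) presburger+
qed

lemma grid_label_range:
  assumes "c \<in> {- int g..int g}" "k < 2 * m + 1"
  shows "0 \<le> grid_label g m k c" "grid_label g m k c < (2 * int g + 1) * (2 * int m + 1)"
proof -
  note r = grid_label_residue_range[OF assms(1), of k m]
  have "0 \<le> (2 * int g + 1) * int k" by simp
  then show "0 \<le> grid_label g m k c" unfolding grid_label_def using r(1) by linarith
  have "(2 * int g + 1) * int k \<le> (2 * int g + 1) * (2 * int m)"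
    using assms(2) by (intro mult_left_mono) auto
  moreover have "(2 * int g + 1) * (2 * int m + 1) = (2 * int g + 1) * (2 * int m) + (2 * int g + 1)"
    by (simp add: algebra_simps)
  ultimately show "grid_label g m k c < (2 * int g + 1) * (2 * int m + 1)"
    unfolding grid_label_def using r(2) by linarith
qed

lemma sum_grid_label:
  "(\<Sum>c\<in>Y. grid_label g m k c) = int (card Y) * ((2 * int g + 1) * int k + int g) +
     (if k = 2 * m then \<Sum>Y else if m \<le> k then sum (shift g) Y
      else - sum (shift g) Y - (if k = 0 then \<Sum>Y else 0))"
  by (simp add: grid_label_def sum.distrib sum_subtractf sum_negf distrib_left)

lemma sum_grid_label_top:
  "(\<Sum>c\<in>Y. grid_label g m (2 * m) c) = int (card Y) * ((2 * int g + 1) * (2 * int m) + int g) + \<Sum>Y"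
  by (simp add: sum_grid_label)

lemma sum_grid_label_high:
  assumes "m \<le> k" "k < 2 * m"
  shows "(\<Sum>c\<in>Y. grid_label g m k c) = int (card Y) * ((2 * int g + 1) * int k + int g) + sum (shift g) Y"
  using assms by (simp add: sum_grid_label)

lemma sum_grid_label_low:
  assumes "k < m"
  shows "(\<Sum>c\<in>Y. grid_label g m k c) = int (card Y) * ((2 * int g + 1) * int k + int g)
    - sum (shift g) Y - (if k = 0 then \<Sum>Y else 0)"
  using assms by (simp add: sum_grid_label)

text \<open>Since \<open>shift g (- int g) = 0\<close>, this row is an arithmetic progression apart
  from its two ends.\<close>

lemma grid_label_bottom:
  "grid_label g m k (- int g) = (2 * int g + 1) * int k + int g
     + (if k = 2 * m then - int g else if k = 0 \<and> 0 < m then int g else 0)"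
  by (simp add: grid_label_def shift_def)

text \<open>The residues cancel: \<open>m\<close> copies of \<open>- shift g c\<close> against
  \<open>m\<close> copies of \<open>shift g c\<close>, and \<open>- c\<close> at
  \<open>k = 0\<close> against \<open>c\<close> at \<open>k = 2 * m\<close>.\<close>

lemma sum_grid_label_row:
  assumes "1 \<le> m"
  shows "(\<Sum>k<2 * m + 1. grid_label g m k c) = (2 * int m + 1) * ((2 * int g + 1) * int m + int g)"
proof -
  define F where "F k = (if k = 2 * m then c else if m \<le> k then shift g c
    else - shift g c - (if k = 0 then c else 0))" for k
  have "sum F {..<m} = (\<Sum>k<m. - shift g c) - (\<Sum>k<m. if k = 0 then c else 0)"
    unfolding sum_subtractf[symmetric] by (intro sum.cong) (auto simp: F_def)
  also have "\<dots> = - (int m * shift g c) - c" using assms by (simp add: sum.delta)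
  finally have low: "sum F {..<m} = - (int m * shift g c) - c" .
  have high: "sum F {m..<2 * m} = int m * shift g c"
    by (simp add: F_def)
  have split: "{..<2 * m} = {..<m} \<union> {m..<2 * m}" by auto
  have "sum F {..<2 * m} = sum F {..<m} + sum F {m..<2 * m}"
    unfolding split by (intro sum.union_disjoint) auto
  then have "sum F {..<2 * m + 1} = 0" using low high by (simp add: F_def)
  moreover have "(\<Sum>k<2 * m + 1. grid_label g m k c)
      = (2 * int g + 1) * (\<Sum>k<2 * m + 1. int k) + (2 * int m + 1) * int g + sum F {..<2 * m + 1}"
    unfolding grid_label_def F_def[symmetric] by (simp add: sum.distrib sum_distrib_left algebra_simps)
  moreover have "(\<Sum>k<2 * m + 1. int k) = (2 * int m + 1) * int m"
    using double_sum_int_lessThan[of "2 * m + 1"] by (simp add: algebra_simps)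
  ultimately have "(\<Sum>k<2 * m + 1. grid_label g m k c)
      = (2 * int g + 1) * ((2 * int m + 1) * int m) + (2 * int m + 1) * int g + 0"
    by (simp only:)
  then show ?thesis by (simp add: algebra_simps)
qed

text \<open>Columns \<open>2 * i + 1\<close> and \<open>2 * i + 2\<close> receive
  \<open>m + i\<close> and \<open>i\<close> here, but \<open>m - 1 - i\<close> and
  \<open>2 * m - 1 - i\<close> under \<open>falling\<close>. A rising and a falling row together
  thus contribute \<open>2 * m - 1\<close> in every column except \<open>0\<close>.\<close>

definition rising :: "nat \<Rightarrow> nat \<Rightarrow> nat" where
  "rising m j = (if j = 0 then 2 * m else if odd j then m + j div 2 else j div 2 - 1)"

definition falling :: "nat \<Rightarrow> nat \<Rightarrow> nat" where
  "falling m j = (if j = 0 then 2 * m else if odd j then m - 1 - j div 2 else 2 * m - j div 2)"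

definition steep :: "nat \<Rightarrow> nat \<Rightarrow> nat" where
  "steep m j = (if j = 0 then 2 * m else if odd j then j else j - 2)"

text \<open>The order along the cycle edges: the two edges at vertex \<open>j\<close> contribute
  \<open>2 * m\<close> for odd \<open>j\<close>, \<open>2 * m - 1\<close> for even
  \<open>j > 0\<close>, and \<open>3 * m\<close> for \<open>j = 0\<close>.\<close>

definition zigzag :: "nat \<Rightarrow> nat \<Rightarrow> nat" where
  "zigzag m j = (if even j then 2 * m - j div 2 else j div 2)"

lemma bij_betw_rising: "bij_betw (rising m) {..<2 * m + 1} {..<2 * m + 1}"
proof -
  have "inj_on (rising m) {..<2 * m + 1}"
    by (auto simp: inj_on_def rising_def split: if_splits elim!: oddE evenE)
  moreover have "rising m ` {..<2 * m + 1} \<subseteq> {..<2 * m + 1}"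
    by (auto simp: rising_def elim!: oddE evenE)
  ultimately show ?thesis by (simp add: bij_betw_def endo_inj_surj)
qed

lemma bij_betw_falling: "bij_betw (falling m) {..<2 * m + 1} {..<2 * m + 1}"
proof -
  have "inj_on (falling m) {..<2 * m + 1}"
    by (auto simp: inj_on_def falling_def split: if_splits elim!: oddE evenE)
  moreover have "falling m ` {..<2 * m + 1} \<subseteq> {..<2 * m + 1}"
    by (auto simp: falling_def elim!: oddE evenE)
  ultimately show ?thesis by (simp add: bij_betw_def endo_inj_surj)
qed

lemma bij_betw_steep: "bij_betw (steep m) {..<2 * m + 1} {..<2 * m + 1}"
proof -
  have "inj_on (steep m) {..<2 * m + 1}"
    by (auto simp: inj_on_def steep_def split: if_splits elim!: oddE evenE) presburger+
  moreover have "steep m ` {..<2 * m + 1} \<subseteq> {..<2 * m + 1}"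
    by (auto simp: steep_def elim!: oddE evenE)
  ultimately show ?thesis by (simp add: bij_betw_def endo_inj_surj)
qed

lemma bij_betw_zigzag: "bij_betw (zigzag m) {..<2 * m + 1} {..<2 * m + 1}"
proof -
  have "inj_on (zigzag m) {..<2 * m + 1}"
    by (auto simp: inj_on_def zigzag_def split: if_splits elim!: oddE evenE)
  moreover have "zigzag m ` {..<2 * m + 1} \<subseteq> {..<2 * m + 1}"
    by (auto simp: zigzag_def elim!: oddE evenE)
  ultimately show ?thesis by (simp add: bij_betw_def endo_inj_surj)
qed

section \<open>Balanced sets of rows and the colour pattern of an odd cycle\<close>

lemma sum_symmetric_interval: "\<Sum>{- int h..int h} = 0"
proof (induction h)
  case (Suc h)
  have "{- int (Suc h)..int (Suc h)} = insert (- int (Suc h)) (insert (int (Suc h)) {- int h..int h})"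
    by auto
  then show ?case using Suc by simp
qed simp

text \<open>A pair \<open>c\<close>, \<open>- c\<close> with \<open>c > 0\<close> contributes
  \<open>- 1\<close>, and \<open>c = 0\<close> contributes \<open>g\<close>.\<close>

lemma sum_shift_symmetric_interval: "sum (shift g) {- int h..int h} = int g - int h"
proof (induction h)
  case (Suc h)
  have "{- int (Suc h)..int (Suc h)} = insert (- int (Suc h)) (insert (int (Suc h)) {- int h..int h})"
    by auto
  then show ?case using Suc by (simp add: shift_def)
qed (simp add: shift_def)

text \<open>These are the candidates for the set of falling rows. Symmetry makes the sum of the set
  vanish, and dropping \<open>0\<close> adjusts the parity of its size.\<close>

lemma balanced_rows:
  assumes "h < g"
  shows "B = {- int h..int h} \<Longrightarrow> B \<subseteq> {- int g<..<int g} \<and> card B = 2 * h + 1 \<and> \<Sum>B = 0 \<and> sum (shift g) B = int g - int h"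
    and "B = {- int h..int h} - {0} \<Longrightarrow> B \<subseteq> {- int g<..<int g} \<and> card B = 2 * h \<and> \<Sum>B = 0 \<and> sum (shift g) B = - int h"
  using assms sum_symmetric_interval[of h] sum_shift_symmetric_interval[of g h]
  by (auto simp: sum_diff1 shift_def[of g 0])

text \<open>The colours \<open>a\<close> and \<open>b\<close> alternate on the path left after
  removing vertex \<open>0\<close>, and \<open>v\<close> exceeds both, so the two edges at
  \<open>0\<close> cause no conflict.\<close>

lemma odd_columns:
  fixes S :: "nat \<Rightarrow> int"
  assumes "1 \<le> m" and S: "S 0 = v" "\<And>i. i < m \<Longrightarrow> S (2 * i + 1) = a" "\<And>i. i < m \<Longrightarrow> S (2 * i + 2) = b"
    and ne: "a \<noteq> b" "a < v" "b < v" and R: "R \<le> a" "R \<le> b"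
  shows "(\<forall>j<2 * m + 1. R \<le> S j) \<and> (\<forall>j<2 * m + 1. S j \<noteq> S (Suc j mod (2 * m + 1)))
    \<and> card (S ` {..<2 * m + 1}) \<le> 3"
proof -
  have val: "S j = (if j = 0 then v else if odd j then a else b)" if "j < 2 * m + 1" for j
  proof -
    consider "j = 0" | i where "j = 2 * i + 1" | i where "j = 2 * i + 2"
      by (cases "even j"; cases "j = 0") (auto elim!: oddE evenE, metis Suc_pred add_2_eq_Suc' gr0I mult_Suc_right add.commute)
    then show ?thesis using that S by cases auto
  qed
  have "S ` {..<2 * m + 1} \<subseteq> {v, a, b}" using val by auto
  then have "card (S ` {..<2 * m + 1}) \<le> card {v, a, b}" by (intro card_mono) auto
  moreover have "S j \<noteq> S (Suc j mod (2 * m + 1))" if j: "j < 2 * m + 1" for j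
  proof (cases "j = 2 * m")
    case True
    then show ?thesis using val[of j] S(1) ne assms(1) by auto
  next
    case False
    then have "Suc j mod (2 * m + 1) = Suc j" "Suc j < 2 * m + 1" using j by auto
    then show ?thesis using val[OF j] val[of "Suc j"] ne assms(1) by auto
  qed
  ultimately show ?thesis using val ne R by (auto simp: card_insert_if split: if_splits)
qed

text \<open>The row \<open>c = - g\<close> of the grid is left out and its labels are spent on the cycle; this is how
  the rows can have equal sums although \<open>p * n\<close> consecutive labels would not allow it.\<close>

lemma label_array_odd_even:
  assumes m: "1 \<le> m" "m < g"
  obtains M X where "label_array {- int g<..int g} (2 * m + 1) 3 M X"
proof -
  let ?I = "{- int g<..int g}" and ?n = "2 * m + 1" and ?Q = "2 * int g + 1"
  \<comment> \<open>\<open>B\<close> holds the falling rows: half of all rows, so that each is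
    paired with a rising one.\<close>
  obtain B where B: "B \<subseteq> {- int g<..<int g}" "card B = g" "\<Sum>B = 0"
    and \<tau>: "2 * sum (shift g) B = - int g \<or> 2 * sum (shift g) B = int g + 1"
  proof (cases "even g")
    case True
    then obtain h where "g = 2 * h" by (elim evenE)
    then show ?thesis using balanced_rows(2)[of h g] m by (intro that[of "{- int h..int h} - {0}"]) auto
  next
    case False
    then obtain h where "g = 2 * h + 1" by (elim oddE)
    then show ?thesis using balanced_rows(1)[of h g] m by (intro that[of "{- int h..int h}"]) auto
  qed
  define \<tau> where "\<tau> = sum (shift g) B"
  define A where "A = ?I - B"
  have BI: "B \<subseteq> ?I" using B(1) by auto
  have finB: "finite B" using finite_subset[OF BI] by simp
  have full: "{- int g..int g} = insert (- int g) ?I" by auto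
  have I: "\<Sum>?I = int g" "sum (shift g) ?I = 0"
    using sum_symmetric_interval[of g] sum_shift_symmetric_interval[of g g]
    unfolding full by (simp_all add: shift_def[of g "- int g"])
  have cA: "card A = g" using BI B(2) finB by (simp add: A_def card_Diff_subset)
  have A: "\<Sum>A = int g" "sum (shift g) A = - \<tau>"
    unfolding A_def using BI I B(3) by (simp_all add: sum_diff \<tau>_def)
  define K where "K c = (if c \<in> B then falling m else rising m)" for c :: int
  define M where "M c j = grid_label g m (K c j) c" for c j
  define X where "X j = grid_label g m (zigzag m j) (- int g)" for j
  let ?S = "column_sum ?I ?n M X"
  have K: "bij_betw (K c) {..<?n} {..<?n}" for c
    using bij_betw_rising[of m] bij_betw_falling[of m] by (auto simp: K_def)
  have sumM: "(\<Sum>c\<in>?I. M c j) = (\<Sum>c\<in>A. grid_label g m (rising m j) c) + (\<Sum>c\<in>B. grid_label g m (falling m j) c)" for j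
  proof -
    have "(\<Sum>c\<in>?I. M c j) = (\<Sum>c\<in>A. M c j) + (\<Sum>c\<in>B. M c j)"
      unfolding A_def using BI by (intro sum.subset_diff) auto
    also have "(\<Sum>c\<in>A. M c j) = (\<Sum>c\<in>A. grid_label g m (rising m j) c)"
      by (intro sum.cong) (auto simp: M_def K_def A_def)
    also have "(\<Sum>c\<in>B. M c j) = (\<Sum>c\<in>B. grid_label g m (falling m j) c)"
      by (intro sum.cong) (auto simp: M_def K_def)
    finally show ?thesis .
  qed
  \<comment> \<open>\<open>a\<close>, \<open>b\<close> and \<open>v\<close> will be the sums of the
    odd columns, of the even columns other than \<open>0\<close>, and of column
    \<open>0\<close>.\<close>
  define a where "a = int g * ?Q * (2 * int m - 1) + 2 * int g * int g - 2 * \<tau> + 2 * int m * ?Q + 2 * int g"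
  define b where "b = int g * ?Q * (2 * int m - 1) + 2 * int g * int g + 2 * \<tau> + (2 * int m - 1) * ?Q + 2 * int g"
  define v where "v = 4 * int g * int m * ?Q + 2 * int g * int g + 3 * int m * ?Q + 2 * int g"
  have Sa: "?S (2 * i + 1) = a" if i: "i < m" for i
  proof -
    have ks: "rising m (2 * i + 1) = m + i" "falling m (2 * i + 1) = m - 1 - i"
      "zigzag m (2 * i + 1) = i" "zigzag m (2 * i) = 2 * m - i"
      by (auto simp: rising_def falling_def zigzag_def steep_def)
    have pred: "(2 * i + 1 + ?n - 1) mod ?n = 2 * i" using i pred_mod[of "2 * i + 1" ?n] by simp
    have rA: "(\<Sum>c\<in>A. grid_label g m (m + i) c) = int g * (?Q * (int m + int i) + int g) - \<tau>"
      using i by (simp add: sum_grid_label_high A cA)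
    have "m - 1 - i < m" using i by simp
    then have rB: "(\<Sum>c\<in>B. grid_label g m (m - 1 - i) c) = int g * (?Q * (int m - 1 - int i) + int g) - \<tau>"
      using i by (simp only: sum_grid_label_low) (simp add: B \<tau>_def of_nat_diff algebra_simps)
    have x: "grid_label g m i (- int g) + grid_label g m (2 * m - i) (- int g) = 2 * int m * ?Q + 2 * int g"
      using i by (auto simp: grid_label_bottom of_nat_diff algebra_simps)
    show ?thesis
      unfolding column_sum_def sumM X_def pred ks rA rB using x by (simp add: a_def algebra_simps)
  qed
  have Sb: "?S (2 * i + 2) = b" if i: "i < m" for i
  proof -
    have ks: "rising m (2 * i + 2) = i" "falling m (2 * i + 2) = 2 * m - 1 - i"
      "zigzag m (2 * i + 2) = 2 * m - 1 - i" "zigzag m (2 * i + 1) = i"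
      by (auto simp: rising_def falling_def zigzag_def steep_def)
    have pred: "(2 * i + 2 + ?n - 1) mod ?n = 2 * i + 1" using i pred_mod[of "2 * i + 2" ?n] by simp
    have k: "m \<le> 2 * m - 1 - i" "2 * m - 1 - i < 2 * m" "int (2 * m - 1 - i) = 2 * int m - 1 - int i"
      using i by auto
    \<comment> \<open>The loss of \<open>g\<close> at \<open>i = 0\<close> is made up by the cycle
      label with \<open>k = 0\<close> in the row \<open>- g\<close>, see \<open>x\<close>
      below.\<close>
    have rA: "(\<Sum>c\<in>A. grid_label g m i c)
        = int g * (?Q * int i + int g) + \<tau> - (if i = 0 then int g else 0)"
      using i by (simp add: sum_grid_label_low A cA)
    have rB: "(\<Sum>c\<in>B. grid_label g m (2 * m - 1 - i) c)
        = int g * (?Q * (2 * int m - 1 - int i) + int g) + \<tau>"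
      by (simp only: sum_grid_label_high[OF k(1,2)] k(3)) (simp add: B \<tau>_def)
    have x: "grid_label g m i (- int g) + grid_label g m (2 * m - 1 - i) (- int g)
        = (2 * int m - 1) * ?Q + 2 * int g + (if i = 0 then int g else 0)"
      using i k by (auto simp: grid_label_bottom algebra_simps)
    show ?thesis
      unfolding column_sum_def sumM X_def pred ks rA rB using x by (simp add: b_def algebra_simps)
  qed
  have S0: "?S 0 = v"
  proof -
    have ks: "rising m 0 = 2 * m" "falling m 0 = 2 * m" "zigzag m 0 = 2 * m" "zigzag m (2 * m) = m"
      by (auto simp: rising_def falling_def zigzag_def steep_def)
    have pred: "(0 + ?n - 1) mod ?n = 2 * m" by simp
    show ?thesis
      unfolding column_sum_def sumM X_def pred ks sum_grid_label_top using m
      by (simp add: A cA B grid_label_bottom v_def algebra_simps)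
  qed
  define R where "R = (2 * int m + 1) * (?Q * int m + int g)"
  have row: "(\<Sum>j<?n. M c j) = R" for c
    unfolding M_def R_def sum_grid_label_row[OF m(1), of g c, symmetric]
    by (rule sum.reindex_bij_betw[OF K])
  \<comment> \<open>Substituting \<open>g = m + 1 + k\<close> and naming the monomials reduces the
    comparisons of \<open>a\<close>, \<open>b\<close>, \<open>v\<close> and \<open>R\<close> to
    linear arithmetic.\<close>
  obtain k where k: "g = m + 1 + k" using m(2) by (metis add_Suc_right less_iff_Suc_add Suc_eq_plus1 add.commute add.left_commute)
  define m' k' where "m' = int m" "k' = int k"
  define mk mm kk mmk mkk mmm where "mk = m' * k'" "mm = m' * m'" "kk = k' * k'"
    "mmk = m' * (m' * k')" "mkk = m' * (k' * k')" "mmm = m' * (m' * m')"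
  note mon = mk_mm_kk_mmk_mkk_mmm_def
  have g': "int g = m' + 1 + k'" by (simp add: k m'_k'_def)
  have pos: "1 \<le> m'" "0 \<le> k'" using m(1) by (auto simp: m'_k'_def)
  then have nn: "k' \<le> mk" "m' \<le> mm" "0 \<le> kk" "0 \<le> mmk" "0 \<le> mkk" "0 \<le> mmm"
    unfolding mon using mult_right_mono[of 1 m' k'] mult_right_mono[of 1 m' m'] by auto
  \<comment> \<open>\<open>?Q\<close> is odd, so this difference is odd and hence nonzero.\<close>
  have "a - b = ?Q - 4 * \<tau>" by (simp add: a_def b_def algebra_simps)
  then have ab: "a \<noteq> b" by presburger
  have \<tau>': "- int g \<le> 2 * \<tau>" "2 * \<tau> \<le> int g + 1" using \<tau> by (auto simp: \<tau>_def)
  have "v - a = 3 + 5 * k' + 2 * kk + 14 * m' + 14 * mm + 16 * mk + 4 * mkk + 4 * mmm + 8 * mmk + 2 * \<tau>"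
    "v - b = 6 + 7 * k' + 2 * kk + 16 * m' + 14 * mm + 16 * mk + 4 * mkk + 4 * mmm + 8 * mmk - 2 * \<tau>"
    "a - R = 7 * m' + 4 * mm + 10 * mk + 4 * mkk + 4 * mmk - 2 * \<tau>"
    "b - R = 5 * m' + 4 * mm + 10 * mk + 4 * mkk + 4 * mmk + 2 * \<tau> - 3 - 2 * k'"
    unfolding a_def b_def v_def R_def mon by (simp_all add: g' m'_k'_def(1)[symmetric] algebra_simps)
  then have "a < v" "b < v" "R \<le> a" "R \<le> b" using \<tau>' nn pos unfolding g' by linarith+
  note cols = odd_columns[OF m(1) S0 Sa Sb ab this]
  have c_mem: "c \<in> {- int g..int g}" if "c \<in> ?I" for c using that by auto
  have Kless: "K c j < ?n" if "j < ?n" for c j using bij_betwE[OF K] that by blast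
  have inj: "inj_on (\<lambda>(c, j). M c j) (?I \<times> {..<?n})"
  proof (rule inj_on_case_prodI)
    fix c j c' j' assume *: "c \<in> ?I" "j \<in> {..<?n}" "c' \<in> ?I" "j' \<in> {..<?n}" "M c j = M c' j'"
    then have "K c j = K c' j'" "c = c'"
      using grid_label_inj[OF c_mem c_mem] unfolding M_def by blast+
    then show "c = c' \<and> j = j'" using * K[of c] by (auto simp: bij_betw_def inj_on_def)
  qed
  have Xinj: "inj_on X {..<?n}"
  proof (rule inj_onI)
    fix j j' assume *: "j \<in> {..<?n}" "j' \<in> {..<?n}" "X j = X j'"
    then have "zigzag m j = zigzag m j'" using grid_label_inj[of "- int g" g "- int g"] by (auto simp: X_def)
    then show "j = j'" using * bij_betw_zigzag[of m] by (auto simp: bij_betw_def inj_on_def)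
  qed
  have ne: "M c j \<noteq> X i" if "c \<in> ?I" for c i j
    using grid_label_inj[OF c_mem[OF that], of "- int g"] that by (auto simp: M_def X_def)
  have zless: "zigzag m j < ?n" if "j < ?n" for j using bij_betwE[OF bij_betw_zigzag] that by blast
  have "label_array ?I ?n 3 M X"
  proof (rule label_arrayI[where R = R and W = "?Q * (2 * int m + 1)"])
    show "?Q * (2 * int m + 1) = int ((card ?I + 1) * ?n)" by (simp add: algebra_simps)
    show "0 \<le> M c j" "M c j < ?Q * (2 * int m + 1)" if "c \<in> ?I" "j < ?n" for c j
      unfolding M_def using grid_label_range[OF c_mem[OF that(1)] Kless[OF that(2)]] by blast+
    show "0 \<le> X j" "X j < ?Q * (2 * int m + 1)" if "j < ?n" for j
      unfolding X_def using grid_label_range[of "- int g" g, OF _ zless[OF that]] by auto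
  qed (rule inj Xinj row cols ne | simp)+
  then show ?thesis by (rule that)
qed

text \<open>With an odd number of rows the row \<open>c = - g\<close> has no partner. It runs through the columns in
  steps of \<open>2\<close>, which is balanced by having two more falling rows than rising ones.\<close>

lemma label_array_odd_odd:
  assumes m: "1 \<le> m" "m \<le> g" "2 \<le> g"
  obtains M X where "label_array {- int g..int g} (2 * m + 1) 3 M X"
proof -
  let ?I = "{- int g..int g}" and ?n = "2 * m + 1" and ?Q = "2 * int g + 1"
  obtain B where B: "B \<subseteq> {- int g<..<int g}" "card B = g + 1" "\<Sum>B = 0"
    and \<tau>: "2 * sum (shift g) B = int g \<or> 2 * sum (shift g) B = - int g - 1"
  proof (cases "even g")
    case True
    then obtain h where "g = 2 * h" by (elim evenE)
    then show ?thesis using balanced_rows(1)[of h g] m by (intro that[of "{- int h..int h}"]) auto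
  next
    case False
    then obtain h where "g = 2 * h + 1" by (elim oddE)
    \<comment> \<open>The required \<open>Suc h < g\<close> would fail for \<open>g = 1\<close>; the
      array with three rows is given explicitly later.\<close>
    then show ?thesis using balanced_rows(2)[of "Suc h" g] m
      by (intro that[of "{- int (Suc h)..int (Suc h)} - {0}"]) auto
  qed
  define \<tau> where "\<tau> = sum (shift g) B"
  define A where "A = {- int g<..int g} - B"
  have BI: "B \<subseteq> {- int g<..int g}" using B(1) by auto
  have finB: "finite B" using finite_subset[OF BI] by simp
  have full: "?I = insert (- int g) {- int g<..int g}" by auto
  have I: "\<Sum>{- int g<..int g} = int g" "sum (shift g) {- int g<..int g} = 0"
    using sum_symmetric_interval[of g] sum_shift_symmetric_interval[of g g]
    unfolding full by (simp_all add: shift_def[of g "- int g"])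
  have cA: "int (card A) = int g - 1" using BI B(2) finB m by (simp add: A_def card_Diff_subset of_nat_diff)
  have A: "\<Sum>A = int g" "sum (shift g) A = - \<tau>"
    unfolding A_def using BI I B(3) by (simp_all add: sum_diff \<tau>_def)
  define K where "K c = (if c = - int g then steep m else if c \<in> B then falling m else rising m)" for c :: int
  define M where "M c j = grid_label g m (K c j) c" for c j
  \<comment> \<open>The rows now exhaust the grid, so the cycle takes the \<open>n\<close> labels
    above it.\<close>
  define X where "X j = ?Q * (2 * int m + 1) + int (zigzag m j)" for j
  let ?S = "column_sum ?I ?n M X"
  have K: "bij_betw (K c) {..<?n} {..<?n}" for c
    using bij_betw_rising[of m] bij_betw_falling[of m] bij_betw_steep[of m] by (auto simp: K_def)
  have sumM: "(\<Sum>c\<in>?I. M c j) = grid_label g m (steep m j) (- int g)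
      + (\<Sum>c\<in>A. grid_label g m (rising m j) c) + (\<Sum>c\<in>B. grid_label g m (falling m j) c)" for j
  proof -
    have "(\<Sum>c\<in>?I. M c j) = M (- int g) j + (\<Sum>c\<in>{- int g<..int g}. M c j)"
      unfolding full by simp
    also have "(\<Sum>c\<in>{- int g<..int g}. M c j) = (\<Sum>c\<in>A. M c j) + (\<Sum>c\<in>B. M c j)"
      unfolding A_def using BI by (intro sum.subset_diff) auto
    also have "(\<Sum>c\<in>A. M c j) = (\<Sum>c\<in>A. grid_label g m (rising m j) c)"
      by (intro sum.cong) (auto simp: M_def K_def A_def)
    also have "(\<Sum>c\<in>B. M c j) = (\<Sum>c\<in>B. grid_label g m (falling m j) c)"
      using B(1) by (intro sum.cong) (auto simp: M_def K_def)
    finally show ?thesis by (simp add: M_def K_def)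
  qed
  define W where "W = ?Q * (2 * int m + 1)"
  define a where "a = ?Q * int g * (2 * int m - 1) + int g * ?Q - 2 * \<tau> + 2 * W + 2 * int m"
  define b where "b = ?Q * (int g + 1) * (2 * int m - 1) + int g * ?Q + 2 * \<tau> + 2 * W + 2 * int m - 1"
  define v where "v = ?Q * (?Q * (2 * int m) + int g) + 2 * W + 3 * int m"
  have Sa: "?S (2 * i + 1) = a" if i: "i < m" for i
  proof -
    have ks: "rising m (2 * i + 1) = m + i" "falling m (2 * i + 1) = m - 1 - i"
      "zigzag m (2 * i + 1) = i" "zigzag m (2 * i) = 2 * m - i" "steep m (2 * i + 1) = 2 * i + 1"
      by (auto simp: rising_def falling_def zigzag_def steep_def)
    have pred: "(2 * i + 1 + ?n - 1) mod ?n = 2 * i" using i pred_mod[of "2 * i + 1" ?n] by simp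
    have rA: "(\<Sum>c\<in>A. grid_label g m (m + i) c) = (int g - 1) * (?Q * (int m + int i) + int g) - \<tau>"
      using i by (simp add: sum_grid_label_high A cA)
    have "m - 1 - i < m" using i by simp
    then have rB: "(\<Sum>c\<in>B. grid_label g m (m - 1 - i) c) = (int g + 1) * (?Q * (int m - 1 - int i) + int g) - \<tau>"
      using i by (simp only: sum_grid_label_low) (simp add: B \<tau>_def of_nat_diff algebra_simps)
    have "2 * i + 1 \<noteq> 2 * m" by presburger
    then have u: "grid_label g m (2 * i + 1) (- int g) = ?Q * (2 * int i + 1) + int g"
      by (simp add: grid_label_bottom)
    have x: "int i + int (2 * m - i) = 2 * int m" using i by simp
    show ?thesis
      unfolding column_sum_def sumM X_def W_def[symmetric] pred ks rA rB u using x
      by (simp add: a_def algebra_simps)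
  qed
  have Sb: "?S (2 * i + 2) = b" if i: "i < m" for i
  proof -
    have ks: "rising m (2 * i + 2) = i" "falling m (2 * i + 2) = 2 * m - 1 - i"
      "zigzag m (2 * i + 2) = 2 * m - 1 - i" "zigzag m (2 * i + 1) = i" "steep m (2 * i + 2) = 2 * i"
      by (auto simp: rising_def falling_def zigzag_def steep_def)
    have pred: "(2 * i + 2 + ?n - 1) mod ?n = 2 * i + 1" using i pred_mod[of "2 * i + 2" ?n] by simp
    have k: "m \<le> 2 * m - 1 - i" "2 * m - 1 - i < 2 * m" "int (2 * m - 1 - i) = 2 * int m - 1 - int i"
      using i by auto
    have rA: "(\<Sum>c\<in>A. grid_label g m i c)
        = (int g - 1) * (?Q * int i + int g) + \<tau> - (if i = 0 then int g else 0)"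
      using i by (simp add: sum_grid_label_low A cA)
    have rB: "(\<Sum>c\<in>B. grid_label g m (2 * m - 1 - i) c)
        = (int g + 1) * (?Q * (2 * int m - 1 - int i) + int g) + \<tau>"
      by (simp only: sum_grid_label_high[OF k(1,2)] k(3)) (simp add: B \<tau>_def)
    \<comment> \<open>The extra \<open>g\<close> of the unpaired row at \<open>i = 0\<close> cancels
      the loss in \<open>rA\<close>.\<close>
    have u: "grid_label g m (2 * i) (- int g) = ?Q * (2 * int i) + int g + (if i = 0 then int g else 0)"
      using i by (simp add: grid_label_bottom)
    show ?thesis
      unfolding column_sum_def sumM X_def W_def[symmetric] pred ks rA rB u using k(3)
      by (simp add: b_def algebra_simps)
  qed
  have S0: "?S 0 = v"
  proof -
    have ks: "rising m 0 = 2 * m" "falling m 0 = 2 * m" "zigzag m 0 = 2 * m" "zigzag m (2 * m) = m" "steep m 0 = 2 * m"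
      by (auto simp: rising_def falling_def zigzag_def steep_def)
    have pred: "(0 + ?n - 1) mod ?n = 2 * m" by simp
    show ?thesis
      unfolding column_sum_def sumM X_def W_def[symmetric] pred ks sum_grid_label_top using m
      by (simp add: A cA B grid_label_bottom v_def algebra_simps)
  qed
  define R where "R = (2 * int m + 1) * (?Q * int m + int g)"
  have row: "(\<Sum>j<?n. M c j) = R" for c
    unfolding M_def R_def sum_grid_label_row[OF m(1), of g c, symmetric]
    by (rule sum.reindex_bij_betw[OF K])
  obtain k where k: "g = m + k" using m(2) by (metis le_iff_add)
  define m' k' where "m' = int m" "k' = int k"
  define mk mm kk mmk mkk mmm where "mk = m' * k'" "mm = m' * m'" "kk = k' * k'"
    "mmk = m' * (m' * k')" "mkk = m' * (k' * k')" "mmm = m' * (m' * m')"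
  note mon = mk_mm_kk_mmk_mkk_mmm_def
  have g': "int g = m' + k'" by (simp add: k m'_k'_def)
  have pos: "1 \<le> m'" "0 \<le> k'" using m(1) by (auto simp: m'_k'_def)
  then have nn: "k' \<le> mk" "m' \<le> mm" "0 \<le> kk" "0 \<le> mmk" "0 \<le> mkk" "0 \<le> mmm"
    unfolding mon using mult_right_mono[of 1 m' k'] mult_right_mono[of 1 m' m'] by auto
  have \<tau>': "- int g - 1 \<le> 2 * \<tau>" "2 * \<tau> \<le> int g" using \<tau> by (auto simp: \<tau>_def)
  have "b - a = 2 * (int g * (2 * int m - 1) + int m - 1 + 2 * \<tau>)"
    by (simp add: a_def b_def algebra_simps)
  \<comment> \<open>For \<open>m = 1\<close> the expression is \<open>g + 2 * \<tau>\<close>, which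
    equals \<open>2 * g\<close> or \<open>- 1\<close>; for larger \<open>m\<close> it is
    positive.\<close>
  moreover have "int g * (2 * int m - 1) + int m - 1 + 2 * \<tau> \<noteq> 0"
  proof (cases "m = 1")
    case True
    then show ?thesis using \<tau> m by (auto simp: \<tau>_def)
  next
    case False
    then have "int g * 3 \<le> int g * (2 * int m - 1)" using m by (intro mult_left_mono) auto
    then show ?thesis using \<tau>' m by linarith
  qed
  ultimately have ab: "a \<noteq> b" by auto
  have "v - a = k' + 4 * m' + 2 * kk + 10 * mk + 8 * mm + 4 * mkk + 4 * mmm + 8 * mmk + 2 * \<tau>"
    "v - b = 2 + 3 * k' + 4 * m' + 2 * kk + 6 * mk + 4 * mm + 4 * mkk + 4 * mmm + 8 * mmk - 2 * \<tau>"
    "a - R = 2 + 3 * k' + 8 * m' + 6 * mk + 4 * mm + 4 * mkk + 4 * mmk - 2 * \<tau>"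
    "b - R = k' + 8 * m' + 10 * mk + 8 * mm + 4 * mkk + 4 * mmk + 2 * \<tau>"
    unfolding a_def b_def v_def R_def W_def mon by (simp_all add: g' m'_k'_def(1)[symmetric] algebra_simps)
  then have "a < v" "b < v" "R \<le> a" "R \<le> b" using \<tau>' nn pos unfolding g' by linarith+
  note cols = odd_columns[OF m(1) S0 Sa Sb ab this]
  have Kless: "K c j < ?n" if "j < ?n" for c j using bij_betwE[OF K] that by blast
  have inj: "inj_on (\<lambda>(c, j). M c j) (?I \<times> {..<?n})"
  proof (rule inj_on_case_prodI)
    fix c j c' j' assume *: "c \<in> ?I" "j \<in> {..<?n}" "c' \<in> ?I" "j' \<in> {..<?n}" "M c j = M c' j'"
    then have "K c j = K c' j'" "c = c'"
      using grid_label_inj[of c g c'] unfolding M_def by blast+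
    then show "c = c' \<and> j = j'" using * K[of c] by (auto simp: bij_betw_def inj_on_def)
  qed
  have Xinj: "inj_on X {..<?n}"
    using bij_betw_zigzag[of m] by (auto simp: bij_betw_def inj_on_def X_def)
  have zless: "zigzag m j < ?n" if "j < ?n" for j using bij_betwE[OF bij_betw_zigzag] that by blast
  have Mrange: "0 \<le> M c j" "M c j < W" if "c \<in> ?I" "j < ?n" for c j
    using grid_label_range[OF that(1) Kless[OF that(2)]] by (simp_all add: M_def W_def)
  have Xrange: "W \<le> X j" "X j < W + (2 * int m + 1)" if "j < ?n" for j
    using zless[OF that] by (auto simp: X_def W_def)
  have "label_array ?I ?n 3 M X"
  proof (rule label_arrayI[where R = R and W = "W + (2 * int m + 1)"])
    show "W + (2 * int m + 1) = int ((card ?I + 1) * ?n)" by (simp add: W_def algebra_simps)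
    show "M c j < W + (2 * int m + 1)" if "c \<in> ?I" "j < ?n" for c j
      using Mrange(2)[OF that] by linarith
    show "M c j \<noteq> X i" if "c \<in> ?I" "j < ?n" "i < ?n" for c j i
      using Mrange(2)[OF that(1,2)] Xrange(1)[OF that(3)] by linarith
    have "0 \<le> W" by (simp add: W_def)
    then show "0 \<le> X j" if "j < ?n" for j using Xrange(1)[OF that] by linarith
  qed (rule inj Xinj row cols Mrange Xrange | assumption | simp)+
  then show ?thesis by (rule that)
qed

section \<open>Iterated joins\<close>

text \<open>A magic square on \<open>0..8\<close> with line sum \<open>12\<close>; the cycle labels
  \<open>9, 10, 11\<close> then make the three column sums distinct. This covers three rows, where
  \<open>label_array_odd_odd\<close> would need \<open>g = 1\<close>.\<close>

lemma label_array_3_3: "label_array {..<3} 3 3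
    (\<lambda>c j. [[7, 0, 5], [2, 4, 6], [3, 8, 1]] ! c ! j) (\<lambda>j. 9 + int j)"
proof -
  have "{..<3} = {0, 1, 2::nat}" by auto
  moreover have "(\<forall>j<3. P j) \<longleftrightarrow> P 0 \<and> P 1 \<and> P (2::nat)" for P
    by (auto simp: numeral_3_eq_3 less_Suc_eq numeral_2_eq_2)
  ultimately show ?thesis
    unfolding label_array_def by (simp add: column_sum_def inj_on_def)
qed

lemma join_cycle_step:
  fixes G C :: "'a ugraph"
  assumes G: "simple_graph G" "regular_graph d G" "1 \<le> d" and f: "local_antimagic G f"
    and C: "cycle_on n h C" and disj: "verts G \<inter> verts C = {}"
    and dn: "d + n = graph_order G + 2" and np: "n \<le> graph_order G"
    and par: "even n \<Longrightarrow> even (graph_order G)"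
  obtains F where "local_antimagic (graph_join G C) F"
    and "card (vertex_sum (graph_join G C) F ` verts (graph_join G C))
           \<le> card (vertex_sum G f ` verts G) + (if even n then 2 else 3)"
proof -
  define p where "p = graph_order G"
  note step = join_cycle_labeling[OF G f C disj _ dn]
  have n3: "3 \<le> n" using C by (simp add: cycle_on_def)
  show ?thesis
  proof (cases "even n")
    case True
    then obtain m s where ms: "n = 2 * m" "p = 2 * s" using par by (auto simp: p_def elim!: evenE)
    have arr: "label_array {..<2 * s} n 2 (\<lambda>c j. int m * block s c j + offset m c j)
        (\<lambda>j. int m * (4 * int s + int (j mod 2)) + int (j div 2))"
      unfolding ms(1) by (rule label_array_even) (use ms n3 np p_def in auto)
    from step[OF _ arr] show ?thesis using that True ms(2) by (auto simp: p_def)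
  next
    case odd: False
    then obtain m where m: "n = 2 * m + 1" by (elim oddE)
    consider g where "p = 2 * g" | g where "p = 2 * g + 1" "2 \<le> g" | "p = 3" "n = 3"
    proof (cases "even p")
      case True
      then show ?thesis using that(1) by (elim evenE) auto
    next
      case False
      then obtain g where g: "p = 2 * g + 1" by (elim oddE)
      show ?thesis
      proof (cases "2 \<le> g")
        case False
        then have "p = 3" "n = 3" using g n3 np by (auto simp: p_def)
        then show ?thesis by (rule that(3))
      qed (use g that(2) in blast)
    qed
    then show ?thesis
    proof cases
      case (1 g)
      \<comment> \<open>With \<open>n\<close> odd and \<open>p\<close> even,
        \<open>n \<le> p\<close> is strict, which gives \<open>m < g\<close>.\<close>
      obtain M X where arr: "label_array {- int g<..int g} n 3 M X"
        using label_array_odd_even[of m g] m n3 np 1 by (auto simp: p_def)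
      have "card {- int g<..int g} = graph_order G" using 1 by (simp add: p_def)
      from step[OF this arr] show ?thesis using that odd by auto
    next
      case (2 g)
      obtain M X where arr: "label_array {- int g..int g} n 3 M X"
        using label_array_odd_odd[of m g] m n3 np 2 by (auto simp: p_def)
      have "card {- int g..int g} = graph_order G" using 2 by (simp add: p_def)
      from step[OF this arr] show ?thesis using that odd by auto
    next
      case 3
      have "card {..<3::nat} = graph_order G" using 3 by (simp add: p_def)
      from step[OF this, unfolded 3, OF label_array_3_3] show ?thesis using that odd 3 by auto
    qed
  qed
qed

section \<open>Lower bounds from proper colourings\<close>

lemma chromatic_number_le_card:
  assumes "simple_graph G" "proper_coloring G c"
  shows "chromatic_number G \<le> card (c ` verts G)"
proof -
  let ?k = "card (c ` verts G)"
  have fin: "finite (c ` verts G)" using assms by (simp add: simple_graph_def)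
  obtain \<phi> where \<phi>: "bij_betw \<phi> (c ` verts G) {..<?k}"
    using bij_betw_iff_card[OF fin, of "{..<?k}"] by auto
  have "\<phi> (c u) \<noteq> \<phi> (c v)" if uv: "{u, v} \<in> edges G" for u v
  proof -
    have "u \<in> verts G" "v \<in> verts G" using simple_graph_edge_verts[OF assms(1) uv] by auto
    moreover have "c u \<noteq> c v" using assms(2) uv by (simp add: proper_coloring_def)
    ultimately show ?thesis using \<phi> by (auto simp: bij_betw_def inj_on_eq_iff)
  qed
  then have "proper_coloring G (\<phi> \<circ> c)" by (simp add: proper_coloring_def)
  moreover have "(\<phi> \<circ> c) ` verts G \<subseteq> {..<?k}"
    using \<phi> by (auto simp: bij_betw_def)
  ultimately show ?thesis unfolding chromatic_number_def by (intro Least_le) blast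
qed

text \<open>Every vertex of one side is adjacent to every vertex of the other, so the two sides
  share no colour.\<close>

lemma card_colors_graph_join:
  assumes "simple_graph G" "simple_graph H" "proper_coloring (graph_join G H) c"
  shows "proper_coloring G c" "proper_coloring H c"
    and "card (c ` verts (graph_join G H)) = card (c ` verts G) + card (c ` verts H)"
proof -
  show "proper_coloring G c" "proper_coloring H c"
    using assms(3) by (auto simp: proper_coloring_def graph_join_def)
  have "c u \<noteq> c v" if "u \<in> verts G" "v \<in> verts H" for u v
    using assms(3) that by (auto simp: proper_coloring_def graph_join_def)
  then have "c ` verts G \<inter> c ` verts H = {}" by blast
  then show "card (c ` verts (graph_join G H)) = card (c ` verts G) + card (c ` verts H)"
    using assms(1,2) by (simp add: image_Un card_Un_disjoint simple_graph_def)
qed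

lemma proper_coloring_vertex_sum: "local_antimagic G f \<Longrightarrow> proper_coloring G (vertex_sum G f)"
  by (simp add: local_antimagic_def proper_coloring_def)

text \<open>The lower bound is asked of all proper colourings, because that property restricts to
  the two sides of a join.\<close>

lemma chi_la_eqI:
  assumes "local_antimagic G f" "card (vertex_sum G f ` verts G) \<le> t"
    and "\<And>c. proper_coloring G c \<Longrightarrow> t \<le> card (c ` verts G)"
  shows "chi_la G = enat t"
proof (rule antisym)
  show "chi_la G \<le> enat t"
    unfolding chi_la_def using assms(1,2) by (intro INF_lower2[of f]) auto
  show "enat t \<le> chi_la G"
    unfolding chi_la_def using assms(3) proper_coloring_vertex_sum by (intro INF_greatest) auto
qed

text \<open>A finite infimum excludes the empty set, and a nonempty set of \<open>enat\<close>
  values contains its infimum.\<close>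

lemma chi_la_attained:
  assumes "chi_la G = enat t"
  obtains f where "local_antimagic G f" "card (vertex_sum G f ` verts G) = t"
proof -
  let ?A = "(\<lambda>f. enat (card (vertex_sum G f ` verts G))) ` {f. local_antimagic G f}"
  have eq: "Inf ?A = enat t" using assms by (simp add: chi_la_def)
  then have "?A \<noteq> {}" by (auto simp: Inf_enat_def split: if_splits)
  then have "Inf ?A \<in> ?A" by (metis (no_types, lifting) Inf_enat_def LeastI equals0I)
  then show ?thesis using that eq by auto
qed

theorem theorem3p7:
  fixes G :: "'a ugraph" and Gs C :: "nat \<Rightarrow> 'a ugraph" and r p :: nat
  assumes "simple_graph G"
    and "regular_graph (2 * r) G"
    and "graph_order G = p"
    and "r \<ge> 1"
    and "p \<ge> 3"
    and "int p - 2 * int r + 2 \<ge> 2"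
    and "enat (chromatic_number G) = chi_la G"
    and "Gs 0 = G"
    and "\<And>k. graph_iso (cycle_graph (p - 2 * r + 2)) (C k)"
    and "\<And>k. verts (Gs k) \<inter> verts (C k) = {}"
    and "\<And>k. Gs (Suc k) = graph_join (Gs k) (C k)"
  shows "(\<forall>k. simple_graph (Gs (Suc k))
            \<and> regular_graph (2 * r + (k + 1) * (p - 2 * r + 2)) (Gs (Suc k))
            \<and> graph_order (Gs (Suc k)) = p + (k + 1) * (p - 2 * r + 2))
       \<and> (\<forall>k. chi_la (Gs k) = (if even p then chi_la G + enat (2 * k) else chi_la G + enat (3 * k)))"
proof -
  define n where "n = p - 2 * r + 2"
  define t where "t = chromatic_number G"
  define s where "s = (if even n then 2 else 3 :: nat)"
  obtain v where v: "v \<in> verts G" using assms(3,5) by (fastforce simp: graph_order_def)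
  \<comment> \<open>Strictness gives \<open>3 \<le> n\<close>, so each \<open>C k\<close> is a
    genuine cycle, and makes the truncated subtraction in \<open>n\<close> exact.\<close>
  have "2 * r < p"
    using graph_degree_less_order[OF assms(1) v] assms(2,3) v by (auto simp: regular_graph_def)
  then have n: "3 \<le> n" "2 * r + n = p + 2" by (auto simp: n_def)
  then have np: "n \<le> p" using assms(4) by simp
  have parity: "even n \<longleftrightarrow> even p" using n(2) by presburger
  have "\<exists>h. cycle_on n h (C k)" for k
    using graph_iso_cycle_on[OF assms(9)[folded n_def] n(1)] by metis
  then obtain h where h: "\<And>k. cycle_on n (h k) (C k)" by metis
  obtain f0 where f0: "local_antimagic G f0" "card (vertex_sum G f0 ` verts G) = t"
    using chi_la_attained assms(7) unfolding t_def by metis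
  \<comment> \<open>The induction carries an actual labeling to extend, together with a matching
    lower bound for every proper colouring. The two bounds meet at \<open>t + s * k\<close>.\<close>
  have inv: "simple_graph (Gs k) \<and> regular_graph (2 * r + k * n) (Gs k) \<and> graph_order (Gs k) = p + k * n
      \<and> (\<exists>f. local_antimagic (Gs k) f \<and> card (vertex_sum (Gs k) f ` verts (Gs k)) \<le> t + s * k)
      \<and> (\<forall>c. proper_coloring (Gs k) c \<longrightarrow> t + s * k \<le> card (c ` verts (Gs k)))" for k
  proof (induction k)
    case 0
    then show ?case
      using assms(1,2,3,8) f0 chromatic_number_le_card[OF assms(1)] by (auto simp: t_def)
  next
    case (Suc k)
    then obtain f where f: "local_antimagic (Gs k) f" "card (vertex_sum (Gs k) f ` verts (Gs k)) \<le> t + s * k"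
      by blast
    have G: "simple_graph (Gs k)" "regular_graph (2 * r + k * n) (Gs k)" "graph_order (Gs k) = p + k * n"
      using Suc by auto
    have Ck: "simple_graph (C k)" "regular_graph 2 (C k)" "graph_order (C k) = n"
      using simple_graph_cycle_on[OF h] regular_graph_cycle_on[OF h] graph_order_cycle_on[OF h] by auto
    have disj: "verts (Gs k) \<inter> verts (C k) = {}" by (rule assms(10))
    have fin: "finite (verts (Gs k))" "finite (verts (C k))" using G(1) Ck(1) by (auto simp: simple_graph_def)
    \<comment> \<open>Degree and order both grow by \<open>n\<close> in each join, so the same cycle
      length fits at every stage.\<close>
    have dn: "2 * r + k * n + n = graph_order (Gs k) + 2" using G(3) n(2) by simp
    have "1 \<le> 2 * r + k * n" "n \<le> graph_order (Gs k)" "even n \<Longrightarrow> even (graph_order (Gs k))"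
      using assms(4) np parity G(3) by auto
    from join_cycle_step[OF G(1,2) this(1) f(1) h disj dn this(2,3)] f(2)
    have "\<exists>F. local_antimagic (Gs (Suc k)) F \<and>
        card (vertex_sum (Gs (Suc k)) F ` verts (Gs (Suc k))) \<le> t + s * Suc k"
      unfolding assms(11) s_def by (smt (verit) add_le_mono1 add.assoc add.commute le_trans mult_Suc_right)
    moreover have "t + s * Suc k \<le> card (c ` verts (Gs (Suc k)))" if c: "proper_coloring (Gs (Suc k)) c" for c
    proof -
      note split = card_colors_graph_join[OF G(1) Ck(1) c[unfolded assms(11)]]
      have "t + s * k \<le> card (c ` verts (Gs k))" using Suc split(1) by blast
      moreover have "s \<le> card (c ` verts (C k))" using cycle_on_colors[OF h split(2)] by (simp add: s_def)
      ultimately show ?thesis unfolding assms(11) split(3) by simp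
    qed
    moreover have "simple_graph (Gs (Suc k))"
      unfolding assms(11) by (rule simple_graph_join[OF G(1) Ck(1) disj])
    moreover have "regular_graph (2 * r + Suc k * n) (Gs (Suc k))"
      using regular_graph_join[OF G(1) Ck(1) disj G(2) Ck(2)] dn Ck(3)
      unfolding assms(11) by (simp add: ac_simps)
    moreover have "graph_order (Gs (Suc k)) = p + Suc k * n"
      using card_Un_disjoint[OF fin disj] G(3) Ck(3) by (simp add: assms(11) graph_order_def)
    ultimately show ?case by blast
  qed
  have "chi_la (Gs k) = enat (t + s * k)" for k
    using inv[of k] chi_la_eqI by blast
  moreover have "chi_la G = enat t" using assms(7) by (simp add: t_def)
  ultimately have "chi_la (Gs k) = (if even p then chi_la G + enat (2 * k) else chi_la G + enat (3 * k))" for k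
    by (simp add: s_def parity)
  then show ?thesis using inv[of "Suc _"] by (simp add: n_def)
qed

end
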